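(* Let $(X,x_0)$ be a pointed space, $n\geq1$, and let $C(X)$ be the cone over $X$. Let $\hat{x}_t=(x_0,t)\in C(X)$ with $t\neq1$ (i.e. not the vertex). Then $$\mathcal{H}_n(C(X),\hat{x}_t)\cong\frac{\mathcal{H}_n(X,x_0)}{\prod^w_{i\in\mathbb{N}}\pi_n(X,x_0)},$$ where $\prod^w_{i\in\mathbb{N}}\pi_n(X,x_0)$ is regarded as a subgroup of $\mathcal{H}_n(X,x_0)$ via the monomorphism sending $([f_1],\dots,[f_m],e,e,\dots)$ to the class of the map $f:\mathbb{H}^n\to X$ with $f|_{S^n_k}=f_k$ for $k\leq m$ and $f|_{S^n_k}$ constant at $x_0$ for $k>m$.
   Context: For $n\geq1$, the $n$-dimensional Hawaiian earring is $\mathbb{H}^n=\{(r_0,\dots,r_n)\in\mathbb{R}^{n+1} : (r_0-1/k)^2+\sum_{i=1}^n r_i^2=(1/k)^2 \text{ for some } k\in\mathbb{N}\}$ with base point $\theta=(0,\dots,0)$; $S^n_k$ denotes the $n$-sphere of radius $1/k$ in it, each containing $\theta$. For a pointed space $(X,x_0)$, the $n$-Hawaiian group $\mathcal{H}_n(X,x_0)$ is the set of pointed homotopy classes (rel $\{\theta\}$) of continuous maps $f:(\mathbb{H}^n,\theta)\to(X,x_0)$, with group operation $[f][g]=[f\ast g]$, where $(f\ast g)|_{S^n_k}$ is the usual concatenation (as in $\pi_n$) of $f|_{S^n_k}$ and $g|_{S^n_k}$ for each $k$. $\prod^w_{i\in\mathbb{N}}G$ denotes the weak direct product of countably many copies of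 $G$ (sequences with all but finitely many entries trivial). The cone is $C(X)=X\times[0,1]/X\times\{1\}$, with $(x,t)$ denoting the image of $(x,t)$. *)

theory Defs
  imports "HOL-Analysis.Analysis" "HOL-Algebra.Coset"
begin

text \<open>Points of R^(n+1) are modelled as functions nat => real with coordinates
  0..n and all further coordinates zero; the topology is the (product =
  Euclidean) topology of nat => real restricted to the earring.\<close>

definition sphere_eq :: "nat \<Rightarrow> nat \<Rightarrow> (nat \<Rightarrow> real) \<Rightarrow> bool" where
  "sphere_eq n k r \<longleftrightarrow>
     (r 0 - 1 / real k)\<^sup>2 + (\<Sum>i=1..n. (r i)\<^sup>2) = (1 / real k)\<^sup>2"

definition HE_sphere :: "nat \<Rightarrow> nat \<Rightarrow> (nat \<Rightarrow> real) set" where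
  "HE_sphere n k = {r. (\<forall>i>n. r i = 0) \<and> sphere_eq n k r}"

definition hawaiian :: "nat \<Rightarrow> (nat \<Rightarrow> real) set" where
  "hawaiian n = (\<Union>k\<in>{1..}. HE_sphere n k)"

definition HE :: "nat \<Rightarrow> (nat \<Rightarrow> real) topology" where
  "HE n = top_of_set (hawaiian n)"

definition theta :: "nat \<Rightarrow> real" where
  "theta = (\<lambda>_. 0)"

definition cube :: "nat \<Rightarrow> (nat \<Rightarrow> real) set" where
  "cube n = {x. (\<forall>i\<in>{1..n}. 0 \<le> x i \<and> x i \<le> 1) \<and> (\<forall>i. i \<notin> {1..n} \<longrightarrow> x i = 0)}"

text \<open>The quotient map I^n -> S^n_k collapsing the boundary of the cube to theta:
  a point at sup-distance d/2 from the centre in (Euclidean) direction u is sent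
  to the point of S^n_k at angle pi*d from the antipode of theta, in direction u.\<close>

definition cube_to_sphere :: "nat \<Rightarrow> nat \<Rightarrow> (nat \<Rightarrow> real) \<Rightarrow> (nat \<Rightarrow> real)" where
  "cube_to_sphere n k x =
     (let y = (\<lambda>i. x i - 1/2);
          d = 2 * Max ((\<lambda>i. \<bar>y i\<bar>) ` {1..n});
          e = sqrt (\<Sum>i=1..n. (y i)\<^sup>2);
          phi = pi * d
      in (\<lambda>i. if i = 0 then 1 / real k + (1 / real k) * cos phi
              else if i \<le> n then (1 / real k) * sin phi * (y i / e)
              else 0))"

definition cube_concat :: "((nat \<Rightarrow> real) \<Rightarrow> 'a) \<Rightarrow> ((nat \<Rightarrow> real) \<Rightarrow> 'a) \<Rightarrow> (nat \<Rightarrow> real) \<Rightarrow> 'a" where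
  "cube_concat F G x =
     (if x 1 \<le> 1/2 then F (x(1 := 2 * x 1)) else G (x(1 := 2 * x 1 - 1)))"

definition he_concat :: "nat \<Rightarrow> 'a \<Rightarrow> ((nat \<Rightarrow> real) \<Rightarrow> 'a) \<Rightarrow> ((nat \<Rightarrow> real) \<Rightarrow> 'a)
                          \<Rightarrow> (nat \<Rightarrow> real) \<Rightarrow> 'a" where
  "he_concat n x0 f g p =
     (if p \<notin> hawaiian n then undefined
      else if p = theta then x0
      else (let (k, x) = (SOME (k, x). k \<ge> 1 \<and> x \<in> cube n \<and> cube_to_sphere n k x = p)
            in cube_concat (f \<circ> cube_to_sphere n k) (g \<circ> cube_to_sphere n k) x))"

definition he_based_map :: "nat \<Rightarrow> 'a topology \<Rightarrow> 'a \<Rightarrow> ((nat \<Rightarrow> real) \<Rightarrow> 'a) \<Rightarrow> bool" where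
  "he_based_map n X x0 f \<longleftrightarrow>
     continuous_map (HE n) X f \<and> f theta = x0 \<and> f \<in> extensional (topspace (HE n))"

text \<open>Pointed homotopy class rel theta (maps taken extensional, to make the classes
  independent of irrelevant values off the earring).\<close>

definition he_class :: "nat \<Rightarrow> 'a topology \<Rightarrow> 'a \<Rightarrow> ((nat \<Rightarrow> real) \<Rightarrow> 'a) \<Rightarrow> ((nat \<Rightarrow> real) \<Rightarrow> 'a) set" where
  "he_class n X x0 f =
     {g. g \<in> extensional (topspace (HE n)) \<and>
         homotopic_with (\<lambda>h. h theta = x0) (HE n) X f g}"

definition hawaiian_group :: "nat \<Rightarrow> 'a topology \<Rightarrow> 'a \<Rightarrow> (((nat \<Rightarrow> real) \<Rightarrow> 'a) set) monoid" where
  "hawaiian_group n X x0 =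
     \<lparr> carrier = {he_class n X x0 f | f. he_based_map n X x0 f},
       mult = (\<lambda>A B. he_class n X x0 (he_concat n x0 (SOME f. f \<in> A) (SOME g. g \<in> B))),
       one = he_class n X x0 (\<lambda>p. if p \<in> hawaiian n then x0 else undefined) \<rparr>"

text \<open>Image of the weak direct product of countably many copies of pi_n(X,x0)
  under the monomorphism ([f_1],...,[f_m],e,e,...) |-> [f], f|S_k = f_k (k<=m),
  f|S_k = const x0 (k>m): exactly the classes of based maps which are constant
  x0 on all but finitely many spheres.\<close>

definition weak_product_sub :: "nat \<Rightarrow> 'a topology \<Rightarrow> 'a \<Rightarrow> ((nat \<Rightarrow> real) \<Rightarrow> 'a) set set" where
  "weak_product_sub n X x0 =
     {he_class n X x0 f | f. he_based_map n X x0 f \<and>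
        (\<exists>m. \<forall>k>m. \<forall>p\<in>HE_sphere n k. f p = x0)}"

text \<open>C(X) = X x [0,1] / X x {1}; the vertex is None, (x,t) with t<1 is Some (x,t).\<close>

definition cone_proj :: "'a \<times> real \<Rightarrow> ('a \<times> real) option" where
  "cone_proj z = (if snd z = 1 then None else Some z)"

definition cone_open :: "'a topology \<Rightarrow> ('a \<times> real) option set \<Rightarrow> bool" where
  "cone_open X U \<longleftrightarrow>
     U \<subseteq> cone_proj ` (topspace X \<times> {0..1}) \<and>
     openin (prod_topology X (top_of_set {0..1::real}))
            {z \<in> topspace X \<times> {0..1}. cone_proj z \<in> U}"

lemma istopology_cone_open: "istopology (cone_open X)"
  unfolding istopology_def cone_open_def
proof (intro conjI allI impI)
  fix S T assume "S \<subseteq> cone_proj ` (topspace X \<times> {0..1}) \<and>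
      openin (prod_topology X (top_of_set {0..1})) {z \<in> topspace X \<times> {0..1}. cone_proj z \<in> S}"
    and "T \<subseteq> cone_proj ` (topspace X \<times> {0..1}) \<and>
      openin (prod_topology X (top_of_set {0..1})) {z \<in> topspace X \<times> {0..1}. cone_proj z \<in> T}"
  then show "S \<inter> T \<subseteq> cone_proj ` (topspace X \<times> {0..1})"
    "openin (prod_topology X (top_of_set {0..1})) {z \<in> topspace X \<times> {0..1}. cone_proj z \<in> S \<inter> T}"
    using openin_Int[of _ "{z \<in> topspace X \<times> {0..1}. cone_proj z \<in> S}"
        "{z \<in> topspace X \<times> {0..1}. cone_proj z \<in> T}"]
    by (auto simp: Collect_conj_eq[symmetric] Int_def conj_ac)
next
  fix K assume K: "\<forall>U\<in>K. U \<subseteq> cone_proj ` (topspace X \<times> {0..1}) \<and>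
      openin (prod_topology X (top_of_set {0..1})) {z \<in> topspace X \<times> {0..1}. cone_proj z \<in> U}"
  then show "\<Union>K \<subseteq> cone_proj ` (topspace X \<times> {0..1})" by blast
  have "{z \<in> topspace X \<times> {0..1}. cone_proj z \<in> \<Union>K} =
        (\<Union>U\<in>K. {z \<in> topspace X \<times> {0..1}. cone_proj z \<in> U})" by blast
  then show "openin (prod_topology X (top_of_set {0..1})) {z \<in> topspace X \<times> {0..1}. cone_proj z \<in> \<Union>K}"
    using K by (auto intro: openin_Union)
qed

definition cone_top :: "'a topology \<Rightarrow> ('a \<times> real) option topology" where
  "cone_top X = topology (cone_open X)"

end

theory Submission
  imports Defs
begin

text \<open>A based map on the earring is a sequence of maps of cubes, constant on the boundary, that tends to
  the base point, and similarly for homotopies. Hence the level map a to (a, t) induces a homomorphism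
  from the Hawaiian group of X to that of the cone. A map into the cone avoids the vertex on all but
  finitely many spheres; on those it can be projected to X, and on the finitely many others it can be
  contracted. So every class comes from X. By the same argument for homotopies, a class of X dies in
  the cone exactly if it is trivial on all but finitely many spheres.\<close>

section \<open>Cubes and spheres\<close>

text \<open>The cone is contractible, but its contraction moves the base point, while homotopies
  here must fix it. A single sphere can still be contracted rel base point: it is pushed to the
  vertex, and a collar of the cube absorbs the motion of the base point. This cannot be done on
  infinitely many spheres at once. The time interval is compact, so the homotopies on late spheres
  stay uniformly near the base point, and since t < 1 some neighbourhood of the base point misses
  the vertex. This is the origin of the finiteness in the weak product. Working with pairs of an
  index k and a cube point x turns continuity at \<open>theta\<close> into one uniform smallness
  condition, which does not see finitely many spheres, so these can be altered freely. The weak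
  product enters as the set of classes with a representative that is constant on almost all spheres;
  its normality is obtained by exhibiting it as a kernel.\<close>

definition sup_norm :: "nat \<Rightarrow> (nat \<Rightarrow> real) \<Rightarrow> real" where
  "sup_norm n y = Max ((\<lambda>i. \<bar>y i\<bar>) ` {1..n})"

definition cube_boundary :: "nat \<Rightarrow> (nat \<Rightarrow> real) set" where
  "cube_boundary n = {x \<in> cube n. \<exists>i\<in>{1..n}. x i = 0 \<or> x i = 1}"

text \<open>The sup norm of the centred vector fixes the latitude and the Euclidean norm only
  normalises the direction: concentric cube shells become parallels of the sphere. This form
  separates the two factors and makes the library facts on \<open>L2_set\<close> applicable.\<close>

lemma cube_to_sphere_alt:
  "cube_to_sphere n k x i =
     (if i = 0 then (1 + cos (2 * pi * sup_norm n (\<lambda>i. x i - 1/2))) / real k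
      else if i \<le> n then sin (2 * pi * sup_norm n (\<lambda>i. x i - 1/2))
             * ((x i - 1/2) / L2_set (\<lambda>i. x i - 1/2) {1..n}) / real k
      else 0)"
proof -
  define s where "s = sup_norm n (\<lambda>i. x i - 1/2)"
  have *: "pi * (2 * s) = 2 * pi * s" by simp
  have "cube_to_sphere n k x i =
     (if i = 0 then 1 / real k + 1 / real k * cos (pi * (2 * s))
      else if i \<le> n then 1 / real k * sin (pi * (2 * s)) * ((x i - 1/2) / L2_set (\<lambda>i. x i - 1/2) {1..n})
      else 0)"
    unfolding cube_to_sphere_def Let_def L2_set_def s_def sup_norm_def by (rule refl)
  then show ?thesis unfolding * by (simp add: s_def[symmetric] add_divide_distrib)
qed

lemma cube_components:
  assumes "x \<in> cube n" shows "0 \<le> x i" "x i \<le> 1"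
  using assms unfolding cube_def by (cases "i \<in> {1..n}"; auto)+

lemma sup_norm_nonneg: "n \<ge> 1 \<Longrightarrow> 0 \<le> sup_norm n y"
  unfolding sup_norm_def by (rule order_trans[of _ "\<bar>y 1\<bar>"]) (auto intro!: Max_ge)

lemma abs_le_sup_norm: "i \<in> {1..n} \<Longrightarrow> \<bar>y i\<bar> \<le> sup_norm n y"
  unfolding sup_norm_def by (auto intro!: Max_ge)

lemma sup_norm_attained: assumes "n \<ge> 1" obtains i where "i \<in> {1..n}" "sup_norm n y = \<bar>y i\<bar>"
proof -
  have "sup_norm n y \<in> (\<lambda>i. \<bar>y i\<bar>) ` {1..n}"
    unfolding sup_norm_def using assms by (intro Max_in) auto
  then show thesis using that by auto
qed

lemma sup_norm_scale:
  assumes "n \<ge> 1" "c \<ge> 0" shows "sup_norm n (\<lambda>i. c * y i) = c * sup_norm n y"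
proof (rule antisym)
  obtain i where "i \<in> {1..n}" "sup_norm n (\<lambda>i. c * y i) = \<bar>c * y i\<bar>"
    using sup_norm_attained[OF assms(1)] by metis
  then show "sup_norm n (\<lambda>i. c * y i) \<le> c * sup_norm n y"
    using abs_le_sup_norm[of i n y] assms by (simp add: abs_mult mult_left_mono)
  obtain i where "i \<in> {1..n}" "sup_norm n y = \<bar>y i\<bar>"
    using sup_norm_attained[OF assms(1)] by metis
  then show "c * sup_norm n y \<le> sup_norm n (\<lambda>i. c * y i)"
    using abs_le_sup_norm[of i n "\<lambda>i. c * y i"] assms by (simp add: abs_mult)
qed

lemma sup_norm_cube:
  assumes "n \<ge> 1" "x \<in> cube n"
  shows "sup_norm n (\<lambda>i. x i - 1/2) \<le> 1/2"
    and "sup_norm n (\<lambda>i. x i - 1/2) = 1/2 \<longleftrightarrow> x \<in> cube_boundary n"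
proof -
  have b: "\<bar>x i - 1/2\<bar> \<le> 1/2" for i
    using cube_components[OF assms(2), of i] by linarith
  show le: "sup_norm n (\<lambda>i. x i - 1/2) \<le> 1/2"
    using sup_norm_attained[OF assms(1), of "\<lambda>i. x i - 1/2"] b by metis
  show "sup_norm n (\<lambda>i. x i - 1/2) = 1/2 \<longleftrightarrow> x \<in> cube_boundary n"
  proof
    assume *: "sup_norm n (\<lambda>i. x i - 1/2) = 1/2"
    obtain i where "i \<in> {1..n}" "sup_norm n (\<lambda>i. x i - 1/2) = \<bar>x i - 1/2\<bar>"
      using sup_norm_attained[OF assms(1)] by metis
    then have "x i = 0 \<or> x i = 1" using * by (auto simp: abs_if split: if_splits)
    then show "x \<in> cube_boundary n" using \<open>i \<in> {1..n}\<close> assms by (auto simp: cube_boundary_def)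
  next
    assume "x \<in> cube_boundary n"
    then obtain i where i: "i \<in> {1..n}" "x i = 0 \<or> x i = 1" by (auto simp: cube_boundary_def)
    then have "\<bar>x i - 1/2\<bar> = 1/2" by auto
    then show "sup_norm n (\<lambda>i. x i - 1/2) = 1/2"
      using abs_le_sup_norm[of i n "\<lambda>i. x i - 1/2"] i le by linarith
  qed
qed

lemma L2_set_eq_0_sup_norm:
  assumes "n \<ge> 1" shows "L2_set y {1..n} = 0 \<longleftrightarrow> sup_norm n y = 0"
proof
  assume "L2_set y {1..n} = 0"
  then have "\<forall>i\<in>{1..n}. y i = 0" by (simp add: L2_set_eq_0_iff)
  then show "sup_norm n y = 0" using sup_norm_attained[OF assms, of y] by force
next
  assume "sup_norm n y = 0"
  then have "\<forall>i\<in>{1..n}. y i = 0" using abs_le_sup_norm[of _ n y] by force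
  then show "L2_set y {1..n} = 0" by (simp add: L2_set_eq_0_iff)
qed

section \<open>Compactness of the cube and continuity of its parametrisation of a sphere\<close>

lemma continuous_on_Max_image:
  fixes f :: "'i \<Rightarrow> 'a::topological_space \<Rightarrow> 'b::linorder_topology"
  assumes "finite A" "A \<noteq> {}" "\<And>i. i \<in> A \<Longrightarrow> continuous_on S (f i)"
  shows "continuous_on S (\<lambda>x. Max ((\<lambda>i. f i x) ` A))"
  using assms by (induction A rule: finite_ne_induct) (auto intro!: continuous_on_max)

lemma continuous_on_component:
  fixes g :: "'a::topological_space \<Rightarrow> 'i \<Rightarrow> 'b::topological_space"
  shows "continuous_on S g \<Longrightarrow> continuous_on S (\<lambda>x. g x i)"
  by (rule continuous_on_product_then_coordinatewise)

lemma continuous_on_sup_norm: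
  assumes "n \<ge> 1" "continuous_on S g"
  shows "continuous_on S (\<lambda>x. sup_norm n (g x))"
  unfolding sup_norm_def
  by (intro continuous_on_Max_image continuous_on_rabs continuous_on_component[OF assms(2)]) (use assms in auto)

text \<open>Tychonoff in the full product over all indices, with the singleton {0} for the
  coordinates outside 1..n. Compactness is what later makes images of closed subsets of cubes closed
  in the earring.\<close>

lemma compact_cube: "compact (cube n)"
proof -
  have eq: "cube n = PiE UNIV (\<lambda>i. if i \<in> {1..n} then {0..1} else {0})"
  proof (rule Set.set_eqI)
    fix x show "x \<in> cube n \<longleftrightarrow> x \<in> PiE UNIV (\<lambda>i. if i \<in> {1..n} then {0..1} else {0})"
      by (auto simp: cube_def PiE_iff split: if_splits)
  qed
  have "compactin (product_topology (\<lambda>i. euclideanreal) UNIV)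
      (PiE UNIV (\<lambda>i::nat. if i \<in> {1..n} then {0..1} else {0}))"
    unfolding compactin_PiE by auto
  then show ?thesis unfolding eq by (simp add: euclidean_product_topology)
qed

text \<open>Made for the centre of the cube, where the direction y / |y| jumps but stays bounded,
  while the sine in front of it tends to 0.\<close>

lemma continuous_within_mult_vanishing:
  fixes f g :: "'a::t2_space \<Rightarrow> real"
  assumes "continuous (at a within S) f" "f a = 0" "\<And>x. \<bar>g x\<bar> \<le> B"
  shows "continuous (at a within S) (\<lambda>x. f x * g x)"
proof -
  have "(f \<longlongrightarrow> 0) (at a within S)" using assms by (simp add: continuous_within)
  then have "((\<lambda>x. \<bar>f x\<bar> * B) \<longlongrightarrow> 0) (at a within S)"
    by (auto intro!: tendsto_mult_left_zero tendsto_rabs_zero)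
  then have "((\<lambda>x. f x * g x) \<longlongrightarrow> 0) (at a within S)"
    by (rule Lim_null_comparison[rotated])
       (auto simp: abs_mult intro!: always_eventually mult_left_mono assms(3))
  then show ?thesis using assms(2) by (simp add: continuous_within)
qed

lemma continuous_on_cube_to_sphere:
  assumes "n \<ge> 1"
  shows "continuous_on S (cube_to_sphere n k)"
proof (rule continuous_on_coordinatewise_then_product)
  fix i
  let ?y = "\<lambda>x i. x i - 1/2 :: real"
  have cx: "continuous_on T (\<lambda>x. ?y x i)" for T :: "(nat \<Rightarrow> real) set" and i
    by (rule continuous_on_diff[OF continuous_on_component[OF continuous_on_id] continuous_on_const])
  have cy: "continuous_on T ?y" for T :: "(nat \<Rightarrow> real) set"
    by (rule continuous_on_coordinatewise_then_product) (rule cx)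
  have cs: "continuous_on T (\<lambda>x. sup_norm n (?y x))" for T
    by (rule continuous_on_sup_norm[OF assms cy])
  have cl: "continuous_on T (\<lambda>x. L2_set (?y x) {1..n})" for T
    unfolding L2_set_def by (intro continuous_on_real_sqrt continuous_on_sum continuous_on_power cx)
  have main: "continuous_on S (\<lambda>x. sin (2 * pi * sup_norm n (?y x)) * (?y x i / L2_set (?y x) {1..n}))"
    if i: "i \<in> {1..n}"
    unfolding continuous_on_eq_continuous_within
  proof
    fix a assume "a \<in> S"
    show "continuous (at a within S) (\<lambda>x. sin (2 * pi * sup_norm n (?y x)) * (?y x i / L2_set (?y x) {1..n}))"
    proof (cases "L2_set (?y a) {1..n} = 0")
      case True
      \<comment> \<open>Division by zero yields 0, so the bound holds at the centre as well.\<close>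
      have "\<bar>?y x i / L2_set (?y x) {1..n}\<bar> \<le> 1" for x
      proof -
        have "\<bar>?y x i\<bar> \<le> L2_set (?y x) {1..n}"
          using member_le_L2_set[of "{1..n}" i "\<lambda>i. \<bar>?y x i\<bar>"] i by (simp add: L2_set_def)
        then show ?thesis
          by (cases "L2_set (?y x) {1..n} = 0") (auto simp: divide_le_eq_1 order_less_le)
      qed
      moreover have "sup_norm n (?y a) = 0"
        using True L2_set_eq_0_sup_norm[OF assms] by blast
      moreover have "continuous (at a within S) (\<lambda>x. sin (2 * pi * sup_norm n (?y x)))"
        using cs[of S] \<open>a \<in> S\<close>
        by (intro continuous_intros) (simp add: continuous_on_eq_continuous_within)
      ultimately show ?thesis by (intro continuous_within_mult_vanishing) auto
    next
      case False
      then show ?thesis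
        using cs[of S] cl[of S] cx[of S i] \<open>a \<in> S\<close>
        unfolding continuous_on_def continuous_within
        by (intro tendsto_mult tendsto_sin tendsto_divide tendsto_const) auto
    qed
  qed
  have c0: "continuous_on S (\<lambda>x. cos (2 * pi * sup_norm n (?y x)))"
    by (intro continuous_on_cos continuous_on_mult continuous_on_const cs)
  consider "i = 0" | "i \<in> {1..n}" | "i \<noteq> 0" "\<not> i \<le> n" by force
  then show "continuous_on S (\<lambda>x. cube_to_sphere n k x i)"
  proof cases
    case 1
    have "continuous_on S (\<lambda>x. (1 + cos (2 * pi * sup_norm n (?y x))) / real k)"
      unfolding divide_inverse[of _ "real k"]
      by (intro continuous_on_mult continuous_on_add continuous_on_const c0)
    then show ?thesis using 1 by (simp add: cube_to_sphere_alt)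
  next
    case 2
    then have "continuous_on S (\<lambda>x. sin (2 * pi * sup_norm n (?y x))
        * (?y x i / L2_set (?y x) {1..n}) / real k)"
      unfolding divide_inverse[of _ "real k"]
      by (intro continuous_on_mult[OF main] continuous_on_const)
    then show ?thesis using 2 by (simp add: cube_to_sphere_alt)
  next
    case 3
    then show ?thesis by (simp add: cube_to_sphere_alt)
  qed
qed

lemma continuous_on_cube_to_sphere_compose:
  "n \<ge> 1 \<Longrightarrow> continuous_on S g \<Longrightarrow> continuous_on S (\<lambda>x. cube_to_sphere n k (g x))"
  by (rule continuous_on_compose2[OF continuous_on_cube_to_sphere[of n UNIV]]) auto

section \<open>Geometry of the spheres and bijectivity of the parametrisation off the
  boundary\<close>

text \<open>Expanding the square cancels 1/k^2 and leaves |p|^2 = 2 p_0 / k. Away from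
  \<open>theta\<close> this forces p_0 > 0, and then k can be read off from the point.\<close>

lemma HE_sphere_iff:
  assumes "k \<ge> 1"
  shows "p \<in> HE_sphere n k \<longleftrightarrow> (\<forall>i>n. p i = 0) \<and> (p 0)\<^sup>2 + (\<Sum>i=1..n. (p i)\<^sup>2) = 2 * p 0 / real k"
  using assms unfolding HE_sphere_def sphere_eq_def
  by (auto simp: power2_diff power_divide)

lemma theta_in_HE_sphere: "k \<ge> 1 \<Longrightarrow> theta \<in> HE_sphere n k"
  by (simp add: HE_sphere_iff theta_def)

lemma HE_sphere_0_pos:
  assumes "k \<ge> 1" "p \<in> HE_sphere n k" "p \<noteq> theta"
  shows "p 0 > 0"
proof (rule ccontr)
  assume "\<not> p 0 > 0"
  then have "2 * p 0 / real k \<le> 0" by (simp add: divide_le_0_iff)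
  moreover have "(p 0)\<^sup>2 + (\<Sum>i=1..n. (p i)\<^sup>2) = 2 * p 0 / real k" "\<forall>i>n. p i = 0"
    using assms HE_sphere_iff by auto
  moreover have "(\<Sum>i=1..n. (p i)\<^sup>2) \<ge> 0" by (simp add: sum_nonneg)
  ultimately have "(p 0)\<^sup>2 = 0" "(\<Sum>i=1..n. (p i)\<^sup>2) = 0"
    using zero_le_power2[of "p 0"] by linarith+
  then have "p i = 0" for i
    using \<open>\<forall>i>n. p i = 0\<close> by (cases "i = 0"; cases "i > n") (auto simp: sum_nonneg_eq_0_iff)
  then show False using \<open>p \<noteq> theta\<close> by (auto simp: theta_def)
qed

lemma HE_sphere_unique:
  assumes "k \<ge> 1" "l \<ge> 1" "p \<in> HE_sphere n k" "p \<in> HE_sphere n l" "p \<noteq> theta"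
  shows "k = l"
proof -
  have "2 * p 0 / real k = 2 * p 0 / real l"
    using assms(3,4) HE_sphere_iff[OF assms(1), of p n] HE_sphere_iff[OF assms(2), of p n] by simp
  then show ?thesis using HE_sphere_0_pos[OF assms(1,3,5)] assms by (simp add: field_simps)
qed

lemma HE_sphere_bound:
  assumes "k \<ge> 1" "p \<in> HE_sphere n k"
  shows "\<bar>p i\<bar> \<le> 2 / real k"
proof -
  define r where "r = 1 / real k"
  have r: "r > 0" using assms(1) by (simp add: r_def)
  have z: "\<forall>i>n. p i = 0" and e: "(p 0 - r)\<^sup>2 + (\<Sum>i=1..n. (p i)\<^sup>2) = r\<^sup>2"
    using assms by (auto simp: HE_sphere_def sphere_eq_def r_def)
  have s: "(\<Sum>i=1..n. (p i)\<^sup>2) \<ge> 0" by (simp add: sum_nonneg)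
  have "\<bar>p i\<bar> \<le> 2 * r"
  proof (cases "i = 0")
    case True
    have "(p 0 - r)\<^sup>2 \<le> r\<^sup>2" using e s by linarith
    then have "\<bar>p 0 - r\<bar> \<le> r" using r abs_le_square_iff[of "p 0 - r" r] by simp
    then have "\<bar>p 0\<bar> \<le> 2 * r" by linarith
    then show ?thesis using True by simp
  next
    case False
    show ?thesis
    proof (cases "i > n")
      case True then show ?thesis using z r by simp
    next
      case False
      then have "(p i)\<^sup>2 \<le> (\<Sum>i=1..n. (p i)\<^sup>2)" using \<open>i \<noteq> 0\<close> by (intro member_le_sum) auto
      then have "(p i)\<^sup>2 \<le> r\<^sup>2" using e zero_le_power2[of "p 0 - r"] by linarith
      then have "\<bar>p i\<bar> \<le> r" using r abs_le_square_iff[of "p i" r] by simp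
      then show ?thesis using r by linarith
    qed
  qed
  then show ?thesis by (simp add: r_def)
qed

text \<open>The cosine is injective on [0, pi], so first coordinate 0 forces the angle pi, that is,
  sup distance 1/2 from the centre. Conversely the sine vanishes at pi and removes the
  direction.\<close>

lemma cube_to_sphere_eq_theta_iff:
  assumes "n \<ge> 1" "k \<ge> 1" "x \<in> cube n"
  shows "cube_to_sphere n k x = theta \<longleftrightarrow> x \<in> cube_boundary n"
proof
  let ?s = "sup_norm n (\<lambda>i. x i - 1/2)"
  assume "cube_to_sphere n k x = theta"
  then have "cube_to_sphere n k x 0 = 0" by (simp add: theta_def)
  then have "cos (2 * pi * ?s) = cos pi" using assms by (simp add: cube_to_sphere_alt)
  moreover have b: "0 \<le> ?s" "?s \<le> 1/2" using sup_norm_nonneg sup_norm_cube assms by auto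
  then have "2 * pi * ?s \<le> pi" "0 \<le> 2 * pi * ?s" using pi_gt_zero by (simp_all add: field_simps)
  ultimately have "2 * pi * ?s = pi" using pi_ge_zero by (metis cos_inj_pi order_refl)
  then have "?s = 1/2" by (simp add: field_simps)
  then show "x \<in> cube_boundary n" using sup_norm_cube assms by blast
next
  assume "x \<in> cube_boundary n"
  then have *: "sup_norm n (\<lambda>i. x i - 1/2) = 1/2" using sup_norm_cube assms by blast
  show "cube_to_sphere n k x = theta"
    unfolding theta_def by (rule ext) (simp add: cube_to_sphere_alt *)
qed

text \<open>The first coordinate determines the angle, hence the sup norm. If the sine is nonzero,
  the other coordinates determine the direction, so the centred vectors differ by a positive factor
  c, and equality of the sup norms gives c = 1.\<close>

lemma cube_to_sphere_inj:
  assumes "n \<ge> 1" "k \<ge> 1" "x \<in> cube n" "x' \<in> cube n"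
    "cube_to_sphere n k x = cube_to_sphere n k x'" "cube_to_sphere n k x \<noteq> theta"
  shows "x = x'"
proof -
  define y where "y = (\<lambda>i. x i - 1/2)"
  define y' where "y' = (\<lambda>i. x' i - 1/2)"
  have b: "0 \<le> sup_norm n y" "sup_norm n y \<le> 1/2" "0 \<le> sup_norm n y'" "sup_norm n y' \<le> 1/2"
    using sup_norm_nonneg sup_norm_cube assms by (auto simp: y_def y'_def)
  then have pb: "0 \<le> 2 * pi * sup_norm n y" "2 * pi * sup_norm n y \<le> pi"
    "0 \<le> 2 * pi * sup_norm n y'" "2 * pi * sup_norm n y' \<le> pi"
    using pi_gt_zero by (simp_all add: field_simps)
  have "cos (2 * pi * sup_norm n y) = cos (2 * pi * sup_norm n y')"
    using fun_cong[OF assms(5), of 0] assms(2) by (simp add: cube_to_sphere_alt y_def y'_def)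
  then have "2 * pi * sup_norm n y = 2 * pi * sup_norm n y'"
    by (rule cos_inj_pi[OF pb])
  then have eq: "sup_norm n y = sup_norm n y'" by simp
  have "y i = y' i" if "i \<in> {1..n}" for i
  proof (cases "sup_norm n y = 0")
    case True
    then show ?thesis using eq abs_le_sup_norm[OF that, of y] abs_le_sup_norm[OF that, of y'] by simp
  next
    case False
    have "sup_norm n y \<noteq> 1/2"
      using assms cube_to_sphere_eq_theta_iff sup_norm_cube(2) unfolding y_def by blast
    then have "0 < sup_norm n y" "sup_norm n y < 1/2" using False b by auto
    then have "2 * pi * sup_norm n y < pi" "2 * pi * sup_norm n y > 0" by (auto simp: field_simps)
    then have sp: "sin (2 * pi * sup_norm n y) > 0" by (intro sin_gt_zero)
    have "L2_set y {1..n} \<noteq> 0" "L2_set y' {1..n} \<noteq> 0"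
      using False eq L2_set_eq_0_sup_norm[OF assms(1)] by auto
    then have L: "L2_set y {1..n} > 0" "L2_set y' {1..n} > 0"
      using L2_set_nonneg by (metis order_less_le)+
    define c where "c = L2_set y {1..n} / L2_set y' {1..n}"
    have "c > 0" using L by (simp add: c_def)
    have q: "y j = c * y' j" if "j \<in> {1..n}" for j
    proof -
      have "sin (2 * pi * sup_norm n y) * (y j / L2_set y {1..n}) / real k
          = sin (2 * pi * sup_norm n y) * (y' j / L2_set y' {1..n}) / real k"
        using fun_cong[OF assms(5), of j] that eq unfolding cube_to_sphere_alt y_def y'_def by auto
      then have "y j / L2_set y {1..n} = y' j / L2_set y' {1..n}"
      proof -
        have *: "sin (2 * pi * sup_norm n y) / real k \<noteq> 0" using sp assms(2) by simp
        assume "sin (2 * pi * sup_norm n y) * (y j / L2_set y {1..n}) / real k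
          = sin (2 * pi * sup_norm n y) * (y' j / L2_set y' {1..n}) / real k"
        then have "sin (2 * pi * sup_norm n y) / real k * (y j / L2_set y {1..n})
          = sin (2 * pi * sup_norm n y) / real k * (y' j / L2_set y' {1..n})"
          by (simp only: times_divide_eq_left)
        then show ?thesis using * mult_cancel_left by blast
      qed
      then show ?thesis using L by (simp add: c_def field_simps)
    qed
    have "sup_norm n y = sup_norm n (\<lambda>i. c * y' i)"
      unfolding sup_norm_def using q by (intro arg_cong[of _ _ Max] image_cong) auto
    also have "\<dots> = c * sup_norm n y'" using assms(1) \<open>c > 0\<close> by (intro sup_norm_scale) auto
    finally have "c = 1" using eq False by simp
    then show ?thesis using q that by simp
  qed
  then show ?thesis
  proof (intro ext)
    fix i
    assume "\<And>i. i \<in> {1..n} \<Longrightarrow> y i = y' i"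
    then show "x i = x' i"
      using assms(3,4) by (cases "i \<in> {1..n}") (force simp: y_def y'_def cube_def)+
  qed
qed

lemma cube_to_sphere_image:
  assumes "n \<ge> 1" "k \<ge> 1"
  shows "cube_to_sphere n k ` cube n = HE_sphere n k"
proof (intro equalityI subsetI)
  fix p assume "p \<in> cube_to_sphere n k ` cube n"
  then obtain x where x: "x \<in> cube n" and p: "p = cube_to_sphere n k x" by auto
  define y where "y = (\<lambda>i. x i - 1/2)"
  define \<phi> where "\<phi> = 2 * pi * sup_norm n y"
  have p0: "p 0 - 1 / real k = cos \<phi> / real k"
    by (simp add: p cube_to_sphere_alt \<phi>_def y_def add_divide_distrib)
  have "(\<Sum>i=1..n. (p i)\<^sup>2) = (\<Sum>i=1..n. (sin \<phi> / real k)\<^sup>2 * ((y i)\<^sup>2 / (L2_set y {1..n})\<^sup>2))"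
    by (intro sum.cong) (auto simp: p cube_to_sphere_alt \<phi>_def y_def power_mult_distrib power_divide)
  also have "\<dots> = (sin \<phi> / real k)\<^sup>2 * ((\<Sum>i=1..n. (y i)\<^sup>2) / (L2_set y {1..n})\<^sup>2)"
    by (simp add: sum_distrib_left sum_divide_distrib)
  also have "\<dots> = (sin \<phi> / real k)\<^sup>2"
  \<comment> \<open>At the centre 0/0 = 0 means that the direction is not a unit vector, but there
    the sine is 0 too.\<close>
  proof (cases "L2_set y {1..n} = 0")
    case True
    then have "\<phi> = 0" using L2_set_eq_0_sup_norm[OF assms(1)] by (simp add: \<phi>_def)
    then show ?thesis by simp
  next
    case False
    moreover have "(\<Sum>i=1..n. (y i)\<^sup>2) = (L2_set y {1..n})\<^sup>2"
      by (simp add: L2_set_def sum_nonneg)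
    ultimately show ?thesis by simp
  qed
  finally have "(p 0 - 1 / real k)\<^sup>2 + (\<Sum>i=1..n. (p i)\<^sup>2) = ((cos \<phi>)\<^sup>2 + (sin \<phi>)\<^sup>2) / (real k)\<^sup>2"
    by (simp only: p0 power_divide add_divide_distrib)
  then show "p \<in> HE_sphere n k"
    by (auto simp: HE_sphere_def sphere_eq_def power_divide p cube_to_sphere_alt)
next
  fix p assume p: "p \<in> HE_sphere n k"
  define u where "u = (\<lambda>i. if i \<in> {1..n} then 1/2 else 0 :: real)"
  show "p \<in> cube_to_sphere n k ` cube n"
  proof (cases "p = theta")
    case True
    have "(\<lambda>_. 0) \<in> cube_boundary n" using assms by (auto simp: cube_boundary_def cube_def)
    moreover from this have "(\<lambda>_. 0) \<in> cube n" by (simp add: cube_boundary_def)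
    ultimately show ?thesis using True cube_to_sphere_eq_theta_iff[OF assms] by (metis image_eqI)
  next
    case False
    \<comment> \<open>An explicit inverse: \<open>a\<close> is the cosine of the angle of p,
      \<open>d\<close> is that angle divided by pi, and p without its first coordinate gives the
      direction.\<close>
    define a where "a = real k * p 0 - 1"
    define E where "E = L2_set p {1..n}"
    define M where "M = sup_norm n p"
    have pos: "p 0 > 0" using HE_sphere_0_pos p False assms by blast
    have z: "\<forall>i>n. p i = 0" and e: "(p 0 - 1 / real k)\<^sup>2 + E\<^sup>2 = (1 / real k)\<^sup>2"
      using p by (auto simp: HE_sphere_def sphere_eq_def E_def L2_set_def sum_nonneg)
    have "a = real k * (p 0 - 1 / real k)" using assms by (simp add: a_def right_diff_distrib)
    moreover have "(real k)\<^sup>2 * ((p 0 - 1 / real k)\<^sup>2 + E\<^sup>2) = 1" using e assms by (simp add: power_divide)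
    ultimately have aE: "a\<^sup>2 + (real k * E)\<^sup>2 = 1"
      by (simp only: power_mult_distrib distrib_left)
    then have "a\<^sup>2 \<le> 1" using zero_le_power2[of "real k * E"] by linarith
    then have a1: "- 1 \<le> a" "a \<le> 1" using abs_le_square_iff[of a 1] by (simp_all add: abs_le_iff)
    define d where "d = arccos a / pi"
    have d: "0 \<le> d" "d \<le> 1" using arccos_bounded[OF a1] by (auto simp: d_def)
    have ca: "cos (pi * d) = a" using a1 by (simp add: d_def)
    have "sin (pi * d) = sqrt (1 - a\<^sup>2)" using a1 by (simp add: d_def sin_arccos)
    also have "\<dots> = sqrt ((real k * E)\<^sup>2)" using aE by (intro arg_cong[of _ _ sqrt]) linarith
    finally have sa: "sin (pi * d) = real k * E" by (simp add: E_def L2_set_nonneg)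
    \<comment> \<open>The factor that gives the vector from the centre the sup norm d / 2. For M = 0
      division by zero gives c = 0, which is right because then d = 0.\<close>
    define c where "c = d / (2 * M)"
    define x where "x = (\<lambda>i. u i + (if i \<in> {1..n} then c * p i else 0))"
    have sn: "sup_norm n (\<lambda>i. x i - 1/2) = \<bar>c\<bar> * M"
    proof -
      have "sup_norm n (\<lambda>i. x i - 1/2) = sup_norm n (\<lambda>i. \<bar>c\<bar> * p i)"
        unfolding sup_norm_def x_def u_def
        by (intro arg_cong[of _ _ Max] image_cong) (auto simp: abs_mult)
      then show ?thesis using sup_norm_scale[OF assms(1)] by (simp add: M_def)
    qed
    have M0: "M \<ge> 0" using sup_norm_nonneg[OF assms(1)] by (simp add: M_def)
    have c0: "c \<ge> 0" using d M0 by (simp add: c_def)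
    \<comment> \<open>With no direction left, p is one of the two poles on the axis, and p 0 > 0
      excludes \<open>theta\<close>; the antipode corresponds to the centre of the cube.\<close>
    have dM: "M = 0 \<Longrightarrow> d = 0"
    proof -
      assume "M = 0"
      then have "E = 0" using L2_set_eq_0_sup_norm[OF assms(1)] by (simp add: E_def M_def)
      then have "a = 1 \<or> a = - 1" using aE by (simp add: power2_eq_1_iff)
      moreover have "a \<noteq> - 1" using pos assms by (simp add: a_def)
      ultimately show "d = 0" by (simp add: d_def)
    qed
    have cM: "c * M = d / 2" using dM by (cases "M = 0") (auto simp: c_def)
    have sn': "sup_norm n (\<lambda>i. x i - 1/2) = d / 2" using sn cM c0 by simp
    have sn2: "2 * pi * sup_norm n (\<lambda>i. x i - 1/2) = pi * d" using sn' by simp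
    have "x \<in> cube n"
    proof -
      have "\<bar>x i - 1/2\<bar> \<le> 1/2" if "i \<in> {1..n}" for i
        using abs_le_sup_norm[OF that, of "\<lambda>i. x i - 1/2"] sn' d by linarith
      then have "0 \<le> x i \<and> x i \<le> 1" if "i \<in> {1..n}" for i
        using that by (simp add: abs_le_iff field_simps)
      then show ?thesis by (auto simp: cube_def x_def u_def)
    qed
    moreover have "cube_to_sphere n k x = p"
    proof
      fix i
      consider "i = 0" | "i > n" | "i \<in> {1..n}" by force
      then show "cube_to_sphere n k x i = p i"
      proof cases
        case 1
        have "cube_to_sphere n k x 0 = (1 + a) / real k"
          by (simp only: cube_to_sphere_alt sn2 ca refl if_True)
        then show ?thesis using 1 assms by (simp add: a_def)
      next
        case 2
        then show ?thesis using z by (simp add: cube_to_sphere_alt)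
      next
        case 3
        have L: "L2_set (\<lambda>i. x i - 1/2) {1..n} = c * E"
        proof -
          have "L2_set (\<lambda>i. x i - 1/2) {1..n} = L2_set (\<lambda>i. c * p i) {1..n}"
            by (rule L2_set_cong) (auto simp: x_def u_def)
          then show ?thesis by (simp only: E_def L2_set_right_distrib[OF c0])
        qed
        show ?thesis
        proof (cases "M = 0")
          case True
          then have "p i = 0" using abs_le_sup_norm[OF 3, of p] by (simp add: M_def)
          moreover have "d = 0" using dM True by simp
          ultimately show ?thesis using 3 by (simp add: cube_to_sphere_alt sn')
        next
          case False
          then have "E \<noteq> 0" using L2_set_eq_0_sup_norm[OF assms(1)] by (simp add: E_def M_def)
          then have "sin (pi * d) \<noteq> 0" using sa assms by simp
          then have "c \<noteq> 0" using False by (auto simp: c_def)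
          have "x i - 1/2 = c * p i" using 3 by (simp add: x_def u_def)
          have "cube_to_sphere n k x i = sin (pi * d) * ((x i - 1/2) / (c * E)) / real k"
            using 3 unfolding cube_to_sphere_alt sn2 L by auto
          also have "\<dots> = sin (pi * d) * ((c * p i) / (c * E)) / real k"
            using \<open>x i - 1/2 = c * p i\<close> by simp
          also have "\<dots> = p i" using \<open>c \<noteq> 0\<close> \<open>E \<noteq> 0\<close> assms by (simp add: sa)
          finally show ?thesis .
        qed
      qed
    qed
    ultimately show ?thesis by (metis image_eqI)
  qed
qed

section \<open>Maps on the earring as sequences of maps of cubes\<close>

lemma hawaiianE:
  assumes "n \<ge> 1" "p \<in> hawaiian n"
  obtains k x where "k \<ge> 1" "x \<in> cube n" "p = cube_to_sphere n k x"
  using assms cube_to_sphere_image[OF assms(1)] unfolding hawaiian_def by (metis UN_E atLeast_iff image_iff)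

lemma cube_to_sphere_in:
  assumes "n \<ge> 1" "k \<ge> 1" "x \<in> cube n"
  shows "cube_to_sphere n k x \<in> HE_sphere n k" "cube_to_sphere n k x \<in> hawaiian n"
  using cube_to_sphere_image[OF assms(1,2)] assms unfolding hawaiian_def by auto

lemma topspace_HE [simp]: "topspace (HE n) = hawaiian n"
  by (simp add: HE_def)

lemma theta_in_hawaiian: "theta \<in> hawaiian n"
  using theta_in_HE_sphere[of 1 n] unfolding hawaiian_def by auto

lemma cube_boundary_subset: "cube_boundary n \<subseteq> cube n"
  by (auto simp: cube_boundary_def)

lemma zero_in_cube_boundary: "n \<ge> 1 \<Longrightarrow> (\<lambda>_. 0) \<in> cube_boundary n"
  by (auto simp: cube_boundary_def cube_def)

text \<open>The parametrised form of a sequence of maps of cubes representing a based map on the earring: a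
  homotopy of based maps is the same as a sequence of homotopies rel boundary that tends to the base
  point uniformly.\<close>

definition cube_homotopy ::
  "nat \<Rightarrow> 'a topology \<Rightarrow> 'a \<Rightarrow> (nat \<Rightarrow> real \<Rightarrow> (nat \<Rightarrow> real) \<Rightarrow> 'a) \<Rightarrow> bool" where
  "cube_homotopy n Y y0 H \<longleftrightarrow>
     (\<forall>k\<ge>1. continuous_map (top_of_set ({0..1} \<times> cube n)) Y (\<lambda>(s, x). H k s x)) \<and>
     (\<forall>k\<ge>1. \<forall>s\<in>{0..1}. \<forall>x\<in>cube_boundary n. H k s x = y0) \<and>
     (\<forall>U. openin Y U \<longrightarrow> y0 \<in> U \<longrightarrow> (\<exists>m. \<forall>k>m. \<forall>s\<in>{0..1}. \<forall>x\<in>cube n. H k s x \<in> U))"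

lemma cube_homotopyI:
  assumes "\<And>k. k \<ge> 1 \<Longrightarrow> continuous_map (top_of_set ({0..1} \<times> cube n)) Y (\<lambda>(s, x). H k s x)"
    and "\<And>k s x. k \<ge> 1 \<Longrightarrow> s \<in> {0..1} \<Longrightarrow> x \<in> cube_boundary n \<Longrightarrow> H k s x = y0"
    and "\<And>U. openin Y U \<Longrightarrow> y0 \<in> U \<Longrightarrow> \<exists>m. \<forall>k>m. \<forall>s\<in>{0..1}. \<forall>x\<in>cube n. H k s x \<in> U"
  shows "cube_homotopy n Y y0 H"
  unfolding cube_homotopy_def by (intro conjI allI impI ballI assms)

lemma cube_homotopyD:
  assumes "cube_homotopy n Y y0 H"
  shows "k \<ge> 1 \<Longrightarrow> continuous_map (top_of_set ({0..1} \<times> cube n)) Y (\<lambda>(s, x). H k s x)"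
    and "k \<ge> 1 \<Longrightarrow> s \<in> {0..1} \<Longrightarrow> x \<in> cube_boundary n \<Longrightarrow> H k s x = y0"
    and "openin Y U \<Longrightarrow> y0 \<in> U \<Longrightarrow> \<exists>m. \<forall>k>m. \<forall>s\<in>{0..1}. \<forall>x\<in>cube n. H k s x \<in> U"
proof -
  note D = assms[unfolded cube_homotopy_def]
  show "k \<ge> 1 \<Longrightarrow> continuous_map (top_of_set ({0..1} \<times> cube n)) Y (\<lambda>(s, x). H k s x)"
    by (rule D[THEN conjunct1, rule_format])
  show "k \<ge> 1 \<Longrightarrow> s \<in> {0..1} \<Longrightarrow> x \<in> cube_boundary n \<Longrightarrow> H k s x = y0"
    by (rule D[THEN conjunct2, THEN conjunct1, rule_format])
  show "openin Y U \<Longrightarrow> y0 \<in> U \<Longrightarrow> \<exists>m. \<forall>k>m. \<forall>s\<in>{0..1}. \<forall>x\<in>cube n. H k s x \<in> U"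
    by (rule D[THEN conjunct2, THEN conjunct2, THEN spec, THEN mp, THEN mp])
qed

text \<open>Uses the very choice of a preimage that \<open>he_concat\<close> makes, so that
  concatenation is literally an instance.\<close>

definition descend :: "nat \<Rightarrow> 'a \<Rightarrow> (nat \<Rightarrow> (nat \<Rightarrow> real) \<Rightarrow> 'a) \<Rightarrow> (nat \<Rightarrow> real) \<Rightarrow> 'a" where
  "descend n y0 F p =
     (if p \<notin> hawaiian n then undefined
      else if p = theta then y0
      else (let (k, x) = (SOME (k, x). k \<ge> 1 \<and> x \<in> cube n \<and> cube_to_sphere n k x = p) in F k x))"

text \<open>Off \<open>theta\<close> the pair (k, x) is unique, so the choice is forced; the
  preimages of \<open>theta\<close> are the boundary points, where the value is assumed to be
  \<open>y0\<close>.\<close>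

lemma descend_cube_to_sphere:
  assumes "n \<ge> 1" "k \<ge> 1" "x \<in> cube n" "x \<in> cube_boundary n \<Longrightarrow> F k x = y0"
  shows "descend n y0 F (cube_to_sphere n k x) = F k x"
proof (cases "cube_to_sphere n k x = theta")
  case True
  then show ?thesis
    using assms cube_to_sphere_eq_theta_iff[OF assms(1-3)] theta_in_hawaiian by (simp add: descend_def)
next
  case False
  let ?P = "\<lambda>(l, y). l \<ge> 1 \<and> y \<in> cube n \<and> cube_to_sphere n l y = cube_to_sphere n k x"
  have "(SOME z. ?P z) = (k, x)"
  proof (rule some_equality)
    show "?P (k, x)" using assms by simp
    fix z assume "?P z"
    then obtain l y where z: "z = (l, y)" "l \<ge> 1" "y \<in> cube n" "cube_to_sphere n l y = cube_to_sphere n k x"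
      by (cases z) auto
    have "l = k"
      using HE_sphere_unique[OF z(2) assms(2), of "cube_to_sphere n k x" n] False
        cube_to_sphere_in(1)[OF assms(1-3)] cube_to_sphere_in(1)[OF assms(1) z(2,3)] z(4) by simp
    then show "z = (k, x)"
      using cube_to_sphere_inj[OF assms(1,2) z(3) assms(3)] z False by simp
  qed
  then show ?thesis
    using False cube_to_sphere_in(2)[OF assms(1-3)] by (simp add: descend_def)
qed

lemma descend_theta: "descend n y0 F theta = y0"
  using theta_in_hawaiian by (simp add: descend_def)

lemma descend_extensional: "descend n y0 F \<in> extensional (hawaiian n)"
  by (simp add: extensional_def descend_def)

lemma he_concat_eq_descend:
  "he_concat n x0 f g = descend n x0 (\<lambda>k. cube_concat (f \<circ> cube_to_sphere n k) (g \<circ> cube_to_sphere n k))"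
  by (rule ext) (simp only: he_concat_def descend_def)

lemma extensional_eq_on_cubes:
  assumes "n \<ge> 1" "f \<in> extensional (hawaiian n)" "g \<in> extensional (hawaiian n)"
    and "\<And>k x. k \<ge> 1 \<Longrightarrow> x \<in> cube n \<Longrightarrow> f (cube_to_sphere n k x) = g (cube_to_sphere n k x)"
  shows "f = g"
  by (rule extensionalityI[OF assms(2,3)]) (metis hawaiianE assms(1,4))

section \<open>Passage between homotopies on the earring and homotopies on cubes\<close>

text \<open>Openness of a preimage is checked at each point: beyond some index the spheres are
  harmless, and each of the finitely many others contributes a compact set of bad points, which can
  be removed. Continuity on every single sphere would not suffice, since the topology at
  \<open>theta\<close> is coarser than that of an infinite wedge; the smallness condition makes up
  for this.\<close>

lemma continuous_map_earring_homotopy: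
  fixes F :: "real \<times> (nat \<Rightarrow> real) \<Rightarrow> 'a"
  assumes n: "n \<ge> 1" and H: "cube_homotopy n Y y0 H"
    and F: "\<And>k s x. k \<ge> 1 \<Longrightarrow> s \<in> {0..1} \<Longrightarrow> x \<in> cube n \<Longrightarrow> F (s, cube_to_sphere n k x) = H k s x"
  shows "continuous_map (prod_topology (top_of_set {0..1}) (HE n)) Y F"
proof -
  have Hc: "continuous_map (top_of_set ({0..1} \<times> cube n)) Y (\<lambda>(s, x). H k s x)" if "k \<ge> 1" for k
    using H that by (simp add: cube_homotopy_def)
  have Hs: "\<exists>m. \<forall>k>m. \<forall>s\<in>{0..1}. \<forall>x\<in>cube n. H k s x \<in> U" if "openin Y U" "y0 \<in> U" for U
    using H that unfolding cube_homotopy_def by blast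
  have F0: "F (s, theta) = y0" if "s \<in> {0..1}" for s
  proof -
    have z: "(\<lambda>_. 0) \<in> cube_boundary n" using n by (rule zero_in_cube_boundary)
    then have "cube_to_sphere n 1 (\<lambda>_. 0) = theta"
      using cube_to_sphere_eq_theta_iff[OF n, of 1] cube_boundary_subset by auto
    then show ?thesis
      using F[of 1 s "\<lambda>_. 0"] H that z cube_boundary_subset unfolding cube_homotopy_def by force
  qed
  have "openin (top_of_set ({0..1} \<times> hawaiian n)) {z \<in> {0..1} \<times> hawaiian n. F z \<in> U}" (is "openin _ ?V")
    if U: "openin Y U" for U
  proof (subst openin_subopen, intro ballI)
    fix z assume z: "z \<in> ?V"
    then obtain s p where sp: "z = (s, p)" "s \<in> {0..1}" "p \<in> hawaiian n" "F (s, p) \<in> U" by auto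
    \<comment> \<open>Late spheres are harmless for one of two reasons: at \<open>theta\<close> they
      are mapped into U by smallness, elsewhere they do not meet O'.\<close>
    obtain O' M where O': "open O'" "p \<in> O'"
      and M: "\<And>l s x. l > M \<Longrightarrow> l \<ge> 1 \<Longrightarrow> s \<in> {0..1} \<Longrightarrow> x \<in> cube n \<Longrightarrow> cube_to_sphere n l x \<in> O' \<Longrightarrow> H l s x \<in> U"
    proof (cases "p = theta")
      case True
      then have "y0 \<in> U" using sp F0 by auto
      then obtain m where "\<forall>k>m. \<forall>s\<in>{0..1}. \<forall>x\<in>cube n. H k s x \<in> U" using Hs U by blast
      then show thesis using that[of UNIV m] by auto
    next
      case False
      then have p0: "p 0 > 0" using sp HE_sphere_0_pos unfolding hawaiian_def by auto
      \<comment> \<open>On sphere l the first coordinate is at most 2 / l, which is below p 0 / 2 as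
        soon as l > 4 / p 0.\<close>
      obtain M :: nat where M: "real M > 4 / p 0" using reals_Archimedean2 by blast
      have "open {q :: nat \<Rightarrow> real. q 0 > p 0 / 2}"
        by (intro open_Collect_less continuous_on_const continuous_on_product_coordinates)
      moreover have "\<not> cube_to_sphere n l x 0 > p 0 / 2" if "l > M" "l \<ge> 1" "x \<in> cube n" for l x
      proof -
        have "cube_to_sphere n l x 0 \<le> 2 / real l"
          using HE_sphere_bound[OF \<open>l \<ge> 1\<close> cube_to_sphere_in(1)[OF n \<open>l \<ge> 1\<close> \<open>x \<in> cube n\<close>], of 0] by linarith
        also have "real l > 4 / p 0" using that M by linarith
        then have "2 / real l < p 0 / 2" using p0 that by (simp add: field_simps)
        finally show ?thesis by linarith
      qed
      ultimately show thesis using that[of "{q. q 0 > p 0 / 2}" M] p0 by auto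
    qed
    \<comment> \<open>The bad points of sphere l. The point z lies in none of these sets, because
      \<open>F\<close> agrees with \<open>H l\<close> at every preimage of p in the cube.\<close>
    define D where "D = (\<lambda>l. (\<lambda>(s, x). (s, cube_to_sphere n l x)) ` {(s, x) \<in> {0..1} \<times> cube n. H l s x \<notin> U})"
    have "closed (D l)" if "l \<ge> 1" for l
    proof -
      have "closedin (top_of_set ({0..1} \<times> cube n)) {w \<in> {0..1} \<times> cube n. (\<lambda>(s, x). H l s x) w \<in> topspace Y - U}"
        using closedin_continuous_map_preimage[OF Hc[OF that], of "topspace Y - U"] U by auto
      moreover have "{w \<in> {0..1} \<times> cube n. (\<lambda>(s, x). H l s x) w \<in> topspace Y - U}
          = {(s, x) \<in> {0..1} \<times> cube n. H l s x \<notin> U}"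
        using funcset_mem[OF continuous_map_funspace[OF Hc[OF that]]] by fastforce
      ultimately have "closedin (top_of_set ({0..1} \<times> cube n)) {(s, x) \<in> {0..1} \<times> cube n. H l s x \<notin> U}"
        by simp
      then have "compact {(s, x) \<in> {0..1} \<times> cube n. H l s x \<notin> U}"
        by (rule closedin_compact[OF compact_Times[OF compact_Icc compact_cube]])
      then have "compact (D l)"
        unfolding D_def case_prod_beta
        by (intro compact_continuous_image continuous_on_Pair continuous_on_fst continuous_on_id
            continuous_on_cube_to_sphere_compose[OF n] continuous_on_snd)
      then show ?thesis by (rule compact_imp_closed)
    qed
    then have "open (UNIV \<times> O' - (\<Union>l\<in>{1..M}. D l))"
      using O' by (intro open_Diff open_Times closed_UN) auto
    then have "openin (top_of_set ({0..1} \<times> hawaiian n)) (({0..1} \<times> hawaiian n) \<inter> (UNIV \<times> O' - (\<Union>l\<in>{1..M}. D l)))"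
      by (rule openin_open_Int)
    moreover have "z \<in> ({0..1} \<times> hawaiian n) \<inter> (UNIV \<times> O' - (\<Union>l\<in>{1..M}. D l))"
      using sp O' F by (auto simp: D_def)
    moreover have "({0..1} \<times> hawaiian n) \<inter> (UNIV \<times> O' - (\<Union>l\<in>{1..M}. D l)) \<subseteq> ?V"
    proof clarsimp
      fix s q assume s: "0 \<le> s" "s \<le> 1" and q: "q \<in> hawaiian n" "q \<in> O'" and D: "\<forall>l\<in>{Suc 0..M}. (s, q) \<notin> D l"
      obtain l x where l: "l \<ge> 1" "x \<in> cube n" "q = cube_to_sphere n l x" using hawaiianE[OF n q(1)] .
      have "H l s x \<in> U"
      proof (cases "l > M")
        case True then show ?thesis using M l q s by auto
      next
        case False
        then have "(s, q) \<notin> D l" using D l by auto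
        then show ?thesis using s l by (force simp: D_def)
      qed
      then show "F (s, q) \<in> U" using F l s by auto
    qed
    ultimately show "\<exists>T. openin (top_of_set ({0..1} \<times> hawaiian n)) T \<and> z \<in> T \<and> T \<subseteq> ?V" by blast
  qed
  moreover have "F z \<in> topspace Y" if z: "z \<in> {0..1} \<times> hawaiian n" for z
  proof -
    obtain s p where "z = (s, p)" "s \<in> {0..1}" "p \<in> hawaiian n" using z by auto
    moreover obtain k x where "k \<ge> 1" "x \<in> cube n" "p = cube_to_sphere n k x"
      using hawaiianE[OF n \<open>p \<in> hawaiian n\<close>] .
    ultimately show ?thesis using F funcset_mem[OF continuous_map_funspace[OF Hc[of k]], of "(s, x)"] by simp
  qed
  ultimately have "continuous_map (top_of_set ({0..1} \<times> hawaiian n)) Y F"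
    unfolding continuous_map_def by auto
  then show ?thesis by (simp add: HE_def)
qed

text \<open>A basic open set of the product restricts only finitely many coordinates, and all
  coordinates on sphere k are bounded by 2 / k.\<close>

lemma small_spheres_in_nbhd:
  assumes "openin (HE n) V" "theta \<in> V"
  shows "\<exists>m. \<forall>k>m. HE_sphere n k \<subseteq> V"
proof -
  obtain T where T: "open T" "V = hawaiian n \<inter> T"
    using assms(1) by (auto simp: HE_def openin_open)
  then obtain X where X: "theta \<in> PiE UNIV X" "\<And>i. open (X i)" "finite {i. X i \<noteq> UNIV}" "PiE UNIV X \<subseteq> T"
    using product_topology_open_contains_basis[of "\<lambda>_. euclideanreal" UNIV T theta] assms(2)
    by (auto simp: euclidean_product_topology)
  have "\<exists>e>0. \<forall>r. \<bar>r\<bar> < e \<longrightarrow> r \<in> X i" for i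
  proof -
    have "0 \<in> X i" using X(1) by (auto simp: theta_def)
    then obtain e where "e > 0" "ball 0 e \<subseteq> X i" using X(2) open_contains_ball by blast
    then show ?thesis by (intro exI[of _ e]) (auto simp: subset_iff)
  qed
  then obtain e where e: "\<And>i. e i > 0" "\<And>i r. \<bar>r\<bar> < e i \<Longrightarrow> r \<in> X i" by metis
  \<comment> \<open>The inserted 1 keeps the minimum meaningful when no coordinate is
    restricted.\<close>
  define d where "d = Min (insert 1 (e ` {i. X i \<noteq> UNIV}))"
  have "d > 0" unfolding d_def using X(3) e(1) by (subst Min_gr_iff) auto
  obtain m :: nat where m: "real m > 2 / d" using reals_Archimedean2 by blast
  have "HE_sphere n k \<subseteq> V" if "k > m" for k
  proof
    fix p assume p: "p \<in> HE_sphere n k"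
    have "k \<ge> 1" using that by simp
    have "real k > 2 / d" using that m by linarith
    then have kd: "2 / real k < d" using \<open>d > 0\<close> \<open>k \<ge> 1\<close> by (simp add: field_simps)
    have "p i \<in> X i" for i
    proof (cases "X i = UNIV")
      case False
      then have "d \<le> e i" unfolding d_def using X(3) by (intro Min_le) auto
      then have "\<bar>p i\<bar> < e i" using HE_sphere_bound[OF \<open>k \<ge> 1\<close> p, of i] kd by linarith
      then show ?thesis by (rule e(2))
    qed simp
    then have "p \<in> T" using X(4) by auto
    moreover have "p \<in> hawaiian n" using p \<open>k \<ge> 1\<close> by (auto simp: hawaiian_def)
    ultimately show "p \<in> V" using T by simp
  qed
  then show ?thesis by blast
qed

text \<open>Uniformity in s comes from the compactness of [0,1]: the tube lemma gives one
  neighbourhood of \<open>theta\<close> that works for all times, and it contains all late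
  spheres.\<close>

lemma cube_homotopy_of_earring_homotopy:
  assumes n: "n \<ge> 1" and F: "continuous_map (prod_topology (top_of_set {0..1::real}) (HE n)) Y F"
    and F0: "\<And>s. s \<in> {0..1} \<Longrightarrow> F (s, theta) = y0"
  shows "cube_homotopy n Y y0 (\<lambda>k s x. F (s, cube_to_sphere n k x))"
  unfolding cube_homotopy_def
proof (intro conjI allI impI ballI)
  fix k :: nat assume k: "k \<ge> 1"
  have "continuous_on ({0..1} \<times> cube n) (\<lambda>z. (fst z, cube_to_sphere n k (snd z)))"
    by (intro continuous_on_Pair continuous_on_fst continuous_on_id continuous_on_snd
        continuous_on_cube_to_sphere_compose[OF n])
  moreover have "(\<lambda>z. (fst z, cube_to_sphere n k (snd z))) \<in> ({0..1} \<times> cube n) \<rightarrow> ({0..1} \<times> hawaiian n)"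
    using cube_to_sphere_in(2)[OF n k] by auto
  ultimately have "continuous_map (top_of_set ({0..1} \<times> cube n)) (prod_topology (top_of_set {0..1}) (HE n))
      (\<lambda>z. (fst z, cube_to_sphere n k (snd z)))"
    by (simp add: HE_def continuous_map_in_subtopology image_subset_iff_funcset)
  from continuous_map_compose[OF this F]
  show "continuous_map (top_of_set ({0..1} \<times> cube n)) Y (\<lambda>(s, x). F (s, cube_to_sphere n k x))"
    by (simp add: o_def case_prod_unfold)
next
  fix k s x assume "1 \<le> (k::nat)" "s \<in> {0..1::real}" "x \<in> cube_boundary n"
  then show "F (s, cube_to_sphere n k x) = y0"
    using cube_to_sphere_eq_theta_iff[OF n, of k x] F0 subsetD[OF cube_boundary_subset] by auto
next
  fix U assume U: "openin Y U" "y0 \<in> U"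
  let ?P = "prod_topology (top_of_set {0..1}) (HE n)"
  have op: "openin ?P {z \<in> topspace ?P. F z \<in> U}"
    using F U(1) by (rule openin_continuous_map_preimage)
  have cp: "compactin (top_of_set {0..1::real}) {0..1}" by (simp add: compactin_subtopology)
  have th: "theta \<in> topspace (HE n)" using theta_in_hawaiian by simp
  have su: "{0..1} \<times> {theta} \<subseteq> {z \<in> topspace ?P. F z \<in> U}"
    using F0 U theta_in_hawaiian by auto
  obtain W V where "{0..1} \<subseteq> W" and V: "openin (HE n) V" "theta \<in> V"
      and WV: "W \<times> V \<subseteq> {z \<in> topspace ?P. F z \<in> U}"
    using tube_lemma_left[OF op cp th su] by blast
  have V3: "F (s, p) \<in> U" if "s \<in> {0..1}" "p \<in> V" for s p
    using that \<open>{0..1} \<subseteq> W\<close> subsetD[OF WV, of "(s, p)"] by blast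
  obtain m where m: "\<forall>k>m. HE_sphere n k \<subseteq> V" using small_spheres_in_nbhd[OF V(1,2)] by blast
  show "\<exists>m. \<forall>k>m. \<forall>s\<in>{0..1}. \<forall>x\<in>cube n. F (s, cube_to_sphere n k x) \<in> U"
  proof (intro exI allI impI ballI)
    fix k s x assume "k > m" "s \<in> {0..1::real}" "x \<in> cube n"
    then have "cube_to_sphere n k x \<in> V" using m cube_to_sphere_in(1)[OF n, of k x] by auto
    then show "F (s, cube_to_sphere n k x) \<in> U" using V3 \<open>s \<in> {0..1}\<close> by auto
  qed
qed

lemma homotopic_of_cube_homotopy:
  assumes n: "n \<ge> 1" and H: "cube_homotopy n Y y0 H"
    and f: "f \<in> extensional (hawaiian n)" and g: "g \<in> extensional (hawaiian n)"
    and Hf: "\<And>k x. k \<ge> 1 \<Longrightarrow> x \<in> cube n \<Longrightarrow> H k 0 x = f (cube_to_sphere n k x)"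
    and Hg: "\<And>k x. k \<ge> 1 \<Longrightarrow> x \<in> cube n \<Longrightarrow> H k 1 x = g (cube_to_sphere n k x)"
  shows "homotopic_with (\<lambda>h. h theta = y0) (HE n) Y f g"
proof -
  have D: "descend n y0 (\<lambda>k. H k s) (cube_to_sphere n k x) = H k s x"
    if "k \<ge> 1" "s \<in> {0..1}" "x \<in> cube n" for k s x
    using H that by (intro descend_cube_to_sphere[OF n]) (auto simp: cube_homotopy_def)
  have "continuous_map (prod_topology (top_of_set {0..1}) (HE n)) Y (\<lambda>(s, p). descend n y0 (\<lambda>k. H k s) p)"
    using continuous_map_earring_homotopy[OF n H, of "\<lambda>(s, p). descend n y0 (\<lambda>k. H k s) p"] D by auto
  moreover have "descend n y0 (\<lambda>k. H k 0) = f" "descend n y0 (\<lambda>k. H k 1) = g"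
    using D Hf Hg f g by (auto intro!: extensional_eq_on_cubes[OF n] descend_extensional)
  ultimately show ?thesis
    unfolding homotopic_with_def
    by (intro exI[of _ "\<lambda>(s, p). descend n y0 (\<lambda>k. H k s) p"]) (auto simp: descend_theta)
qed

lemma cube_homotopy_of_homotopic:
  assumes n: "n \<ge> 1" and fg: "homotopic_with (\<lambda>h. h theta = y0) (HE n) Y f g"
  obtains H where "cube_homotopy n Y y0 H" "\<And>k x. H k 0 x = f (cube_to_sphere n k x)"
    "\<And>k x. H k 1 x = g (cube_to_sphere n k x)"
proof -
  obtain F :: "real \<times> (nat \<Rightarrow> real) \<Rightarrow> 'a" where F: "continuous_map (prod_topology (top_of_set {0..1}) (HE n)) Y F"
    "\<forall>x. F (0, x) = f x" "\<forall>x. F (1, x) = g x" "\<forall>s\<in>{0..1}. F (s, theta) = y0"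
    using fg unfolding homotopic_with_def by blast
  show thesis
    using that[OF cube_homotopy_of_earring_homotopy[OF n F(1)]] F by auto
qed

text \<open>A single map counts as a homotopy constant in s, so that maps and homotopies share one
  notion and one set of closure lemmas.\<close>

lemma he_based_map_cubes:
  assumes n: "n \<ge> 1" and f: "he_based_map n Y y0 f"
  shows "cube_homotopy n Y y0 (\<lambda>k s x. f (cube_to_sphere n k x))"
proof -
  have "continuous_map (prod_topology (top_of_set {0..1}) (HE n)) Y (f \<circ> snd)"
    using f by (intro continuous_map_compose[OF continuous_map_snd]) (simp add: he_based_map_def)
  from cube_homotopy_of_earring_homotopy[OF n this] show ?thesis
    using f by (simp add: he_based_map_def)
qed

lemma he_based_map_descend:
  assumes n: "n \<ge> 1" and F: "cube_homotopy n Y y0 (\<lambda>k s. F k)"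
  shows "he_based_map n Y y0 (descend n y0 F)"
    and "k \<ge> 1 \<Longrightarrow> x \<in> cube n \<Longrightarrow> descend n y0 F (cube_to_sphere n k x) = F k x"
proof -
  from F have "\<forall>k\<ge>1. \<forall>s\<in>{0..1::real}. \<forall>x\<in>cube_boundary n. F k x = y0"
    unfolding cube_homotopy_def by blast
  then have "F k x = y0" if "k \<ge> 1" "x \<in> cube_boundary n" for k x
    using that by (meson atLeastAtMost_iff order_refl zero_le_one)
  then show *: "descend n y0 F (cube_to_sphere n k x) = F k x" if "k \<ge> 1" "x \<in> cube n" for k x
    using that by (intro descend_cube_to_sphere[OF n]) auto
  \<comment> \<open>Continuity is extracted from a homotopy of the map with itself, which the
    constant cube homotopy provides.\<close>
  have "homotopic_with (\<lambda>h. h theta = y0) (HE n) Y (descend n y0 F) (descend n y0 F)"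
    by (rule homotopic_of_cube_homotopy[OF n F descend_extensional descend_extensional]) (simp_all add: *)
  then have "continuous_map (HE n) Y (descend n y0 F)"
    by (simp add: homotopic_with_imp_continuous_maps)
  then show "he_based_map n Y y0 (descend n y0 F)"
    by (simp add: he_based_map_def descend_theta descend_extensional)
qed

section \<open>Operations on sequences of cube maps\<close>

lemma cube_update:
  assumes "x \<in> cube n" "n \<ge> 1" "u \<in> {0..1}" shows "x(1 := u) \<in> cube n"
  using assms by (auto simp: cube_def)

lemma cube_boundary_update:
  assumes "x \<in> cube_boundary n" "n \<ge> 1" "u \<in> {0..1}" "x 1 \<in> {0, 1} \<Longrightarrow> u \<in> {0, 1}"
  shows "x(1 := u) \<in> cube_boundary n"
proof -
  obtain i where i: "i \<in> {1..n}" "x i \<in> {0, 1}" using assms(1) by (auto simp: cube_boundary_def)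
  have "(x(1 := u)) i \<in> {0, 1}" using i assms(4) by (cases "i = 1") auto
  then show ?thesis
    using i cube_update[of x n u] assms cube_boundary_subset unfolding cube_boundary_def by blast
qed

lemma cube_homotopy_cong:
  assumes "cube_homotopy n Y y0 H"
    and "\<And>k s x. k \<ge> 1 \<Longrightarrow> s \<in> {0..1} \<Longrightarrow> x \<in> cube n \<Longrightarrow> H k s x = G k s x"
  shows "cube_homotopy n Y y0 G"
proof (rule cube_homotopyI)
  fix k :: nat assume "k \<ge> 1"
  then show "continuous_map (top_of_set ({0..1} \<times> cube n)) Y (\<lambda>(s, x). G k s x)"
    using assms(2) by (intro continuous_map_eq[OF cube_homotopyD(1)[OF assms(1)]]) auto
next
  fix k s x assume "1 \<le> (k::nat)" "s \<in> {0..1::real}" "x \<in> cube_boundary n"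
  then show "G k s x = y0"
    using cube_homotopyD(2)[OF assms(1)] assms(2)[of k s x] subsetD[OF cube_boundary_subset] by auto
next
  fix U assume "openin Y U" "y0 \<in> U"
  then obtain m where "\<forall>k>m. \<forall>s\<in>{0..1}. \<forall>x\<in>cube n. H k s x \<in> U"
    using cube_homotopyD(3)[OF assms(1)] by blast
  then show "\<exists>m. \<forall>k>m. \<forall>s\<in>{0..1}. \<forall>x\<in>cube n. G k s x \<in> U"
    using assms(2) by (intro exI[of _ m]) auto
qed

text \<open>The same \<psi> serves all spheres, so smallness is inherited without any
  estimate.\<close>

lemma cube_homotopy_pullback:
  assumes H: "cube_homotopy n Y y0 H"
    and c: "continuous_on ({0..1} \<times> cube n) (\<lambda>(s, x). \<psi> s x)"
    and i: "\<And>s x. s \<in> {0..1} \<Longrightarrow> x \<in> cube n \<Longrightarrow> \<psi> s x \<in> cube n"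
    and b: "\<And>s x. s \<in> {0..1} \<Longrightarrow> x \<in> cube_boundary n \<Longrightarrow> \<psi> s x \<in> cube_boundary n"
  shows "cube_homotopy n Y y0 (\<lambda>k s x. H k s (\<psi> s x))"
proof (rule cube_homotopyI)
  fix k :: nat assume "k \<ge> 1"
  have "continuous_on ({0..1} \<times> cube n) (\<lambda>z. (fst z, \<psi> (fst z) (snd z)))"
    using c by (intro continuous_on_Pair continuous_on_fst continuous_on_id) (simp add: case_prod_unfold)
  then have "continuous_map (top_of_set ({0..1} \<times> cube n)) (top_of_set ({0..1} \<times> cube n))
      (\<lambda>z. (fst z, \<psi> (fst z) (snd z)))"
    using i by (auto simp: continuous_map_in_subtopology)
  moreover have "continuous_map (top_of_set ({0..1} \<times> cube n)) Y (\<lambda>(s, x). H k s x)"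
    using \<open>k \<ge> 1\<close> by (rule cube_homotopyD(1)[OF H])
  ultimately have "continuous_map (top_of_set ({0..1} \<times> cube n)) Y
      ((\<lambda>(s, x). H k s x) \<circ> (\<lambda>z. (fst z, \<psi> (fst z) (snd z))))"
    by (rule continuous_map_compose)
  then show "continuous_map (top_of_set ({0..1} \<times> cube n)) Y (\<lambda>(s, x). H k s (\<psi> s x))"
    by (simp add: o_def case_prod_unfold)
next
  fix k s x assume "1 \<le> (k::nat)" "s \<in> {0..1::real}" "x \<in> cube_boundary n"
  then show "H k s (\<psi> s x) = y0" using b by (intro cube_homotopyD(2)[OF H]) auto
next
  fix U assume "openin Y U" "y0 \<in> U"
  then obtain m where "\<forall>k>m. \<forall>s\<in>{0..1}. \<forall>x\<in>cube n. H k s x \<in> U"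
    using cube_homotopyD(3)[OF H] by blast
  then show "\<exists>m. \<forall>k>m. \<forall>s\<in>{0..1}. \<forall>x\<in>cube n. H k s (\<psi> s x) \<in> U"
    using i by blast
qed

lemma cube_homotopy_paste:
  assumes H: "cube_homotopy n Y y0 H" and G: "cube_homotopy n Y y0 G"
    and eq: "\<And>k s x. k \<ge> 1 \<Longrightarrow> s \<in> {0..1} \<Longrightarrow> x \<in> cube n \<Longrightarrow> x 1 = 1/2 \<Longrightarrow> H k s x = G k s x"
  shows "cube_homotopy n Y y0 (\<lambda>k s x. if x 1 \<le> 1/2 then H k s x else G k s x)"
proof (rule cube_homotopyI)
  fix k :: nat assume k: "k \<ge> 1"
  have "continuous_map (top_of_set ({0..1} \<times> cube n)) Y
      (\<lambda>z. if snd z 1 \<le> (\<lambda>_. 1/2) z then (\<lambda>(s, x). H k s x) z else (\<lambda>(s, x). G k s x) z)"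
  proof (rule continuous_map_cases_le)
    show "continuous_map (top_of_set ({0..1} \<times> cube n)) euclideanreal (\<lambda>z. snd z 1)"
      using continuous_on_component[OF continuous_on_snd[OF continuous_on_id]] by auto
    show "continuous_map (top_of_set ({0..1} \<times> cube n)) euclideanreal (\<lambda>z. 1/2)"
      by simp
  qed (use cube_homotopyD(1)[OF H k] cube_homotopyD(1)[OF G k] k eq
        in \<open>auto intro: continuous_map_from_subtopology\<close>)
  then show "continuous_map (top_of_set ({0..1} \<times> cube n)) Y (\<lambda>(s, x). if x 1 \<le> 1/2 then H k s x else G k s x)"
    by (simp only: case_prod_unfold)
next
  fix k s x assume "1 \<le> (k::nat)" "s \<in> {0..1::real}" "x \<in> cube_boundary n"
  then show "(if x 1 \<le> 1/2 then H k s x else G k s x) = y0"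
    using cube_homotopyD(2)[OF H] cube_homotopyD(2)[OF G] by simp
next
  fix U assume U: "openin Y U" "y0 \<in> U"
  obtain m where "\<forall>k>m. \<forall>s\<in>{0..1}. \<forall>x\<in>cube n. H k s x \<in> U"
    using cube_homotopyD(3)[OF H U] by blast
  moreover obtain m' where "\<forall>k>m'. \<forall>s\<in>{0..1}. \<forall>x\<in>cube n. G k s x \<in> U"
    using cube_homotopyD(3)[OF G U] by blast
  ultimately show "\<exists>m. \<forall>k>m. \<forall>s\<in>{0..1}. \<forall>x\<in>cube n. (if x 1 \<le> 1/2 then H k s x else G k s x) \<in> U"
    by (intro exI[of _ "max m m'"]) auto
qed

lemma cube_homotopy_reparam:
  assumes n: "n \<ge> 1" and H: "cube_homotopy n Y y0 H"
    and c: "continuous_on ({0..1} \<times> {0..1}) (\<lambda>(s, u). \<tau> s u)"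
    and i: "\<And>s u. s \<in> {0..1} \<Longrightarrow> u \<in> {0..1} \<Longrightarrow> \<tau> s u \<in> {0..1}"
    and b: "\<And>s. s \<in> {0..1} \<Longrightarrow> \<tau> s 0 \<in> {0, 1}" "\<And>s. s \<in> {0..1} \<Longrightarrow> \<tau> s 1 \<in> {0, 1}"
  shows "cube_homotopy n Y y0 (\<lambda>k s x. H k s (x(1 := \<tau> s (x 1))))"
proof (rule cube_homotopy_pullback[OF H])
  show "continuous_on ({0..1} \<times> cube n) (\<lambda>(s, x). x(1 := \<tau> s (x 1)))"
  proof (rule continuous_on_coordinatewise_then_product)
    fix j
    have cj: "continuous_on ({0..1} \<times> cube n) (\<lambda>z. snd z j)" for j :: nat
      by (rule continuous_on_component[OF continuous_on_snd[OF continuous_on_id]])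
    have "continuous_on ({0..1} \<times> cube n) (\<lambda>z. (\<lambda>(s, u). \<tau> s u) (fst z, snd z 1))"
      by (rule continuous_on_compose2[OF c])
         (auto intro!: continuous_on_Pair continuous_on_fst continuous_on_id cj simp: cube_components)
    then show "continuous_on ({0..1} \<times> cube n) (\<lambda>z. (case z of (s, x) \<Rightarrow> x(1 := \<tau> s (x 1))) j)"
      using cj[of j] by (cases "j = 1") (simp_all add: case_prod_unfold)
  qed
next
  fix s x assume "s \<in> {0..1::real}" "x \<in> cube n"
  then show "x(1 := \<tau> s (x 1)) \<in> cube n"
    using i n by (intro cube_update) (auto simp: cube_components)
next
  fix s x assume s: "s \<in> {0..1::real}" and x: "x \<in> cube_boundary n"
  have "x 1 \<in> {0..1}"
    using x cube_components[OF subsetD[OF cube_boundary_subset]] by auto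
  moreover have "\<tau> s (x 1) \<in> {0, 1}" if "x 1 \<in> {0, 1}"
    using that b[OF s] by (elim insertE emptyE) simp_all
  ultimately show "x(1 := \<tau> s (x 1)) \<in> cube_boundary n"
    by (intro cube_boundary_update[OF x n] i[OF s])
qed

lemma cube_homotopy_concat:
  assumes n: "n \<ge> 1" and H: "cube_homotopy n Y y0 H" and G: "cube_homotopy n Y y0 G"
  shows "cube_homotopy n Y y0 (\<lambda>k s. cube_concat (H k s) (G k s))"
proof -
  \<comment> \<open>Clipping with min and max extends both halves to the whole cube, so that two
    globally defined families are pasted along x 1 = 1/2, where both have the value
    \<open>y0\<close>.\<close>
  have H': "cube_homotopy n Y y0 (\<lambda>k s x. H k s (x(1 := min 1 (2 * x 1))))"
    by (rule cube_homotopy_reparam[OF n H]) (auto simp: case_prod_unfold intro!: continuous_intros)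
  have G': "cube_homotopy n Y y0 (\<lambda>k s x. G k s (x(1 := max 0 (2 * x 1 - 1))))"
    by (rule cube_homotopy_reparam[OF n G]) (auto simp: case_prod_unfold intro!: continuous_intros)
  have bd: "x(1 := u) \<in> cube_boundary n" if "x \<in> cube n" "u \<in> {0, 1}" for x u
    using that n cube_update[of x n u] by (auto simp: cube_boundary_def)
  have "cube_homotopy n Y y0 (\<lambda>k s x. if x 1 \<le> 1/2 then H k s (x(1 := min 1 (2 * x 1)))
      else G k s (x(1 := max 0 (2 * x 1 - 1))))"
  proof (rule cube_homotopy_paste[OF H' G'])
    fix k s x assume *: "1 \<le> (k::nat)" "s \<in> {0..1::real}" "x \<in> cube n" "x 1 = 1/2"
    then have "H k s (x(1 := 1)) = y0" "G k s (x(1 := 0)) = y0"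
      using bd by (auto intro!: cube_homotopyD(2)[OF H] cube_homotopyD(2)[OF G])
    then show "H k s (x(1 := min 1 (2 * x 1))) = G k s (x(1 := max 0 (2 * x 1 - 1)))"
      using * by simp
  qed
  then show ?thesis
    by (rule cube_homotopy_cong) (simp add: cube_concat_def min_absorb2 max_absorb2)
qed

lemma cube_homotopy_const:
  assumes "y0 \<in> topspace Y" shows "cube_homotopy n Y y0 (\<lambda>k s x. y0)"
  using assms by (auto simp: cube_homotopy_def case_prod_unfold)

lemma cube_homotopy_at:
  assumes "cube_homotopy n Y y0 H" "a \<in> {0..1}"
  shows "cube_homotopy n Y y0 (\<lambda>k s. H k a)"
proof (rule cube_homotopyI)
  fix k :: nat assume "k \<ge> 1"
  have "continuous_map (top_of_set ({0..1::real} \<times> cube n)) (top_of_set ({0..1} \<times> cube n)) (\<lambda>z. (a, snd z))"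
    using assms(2) by (auto simp: continuous_map_in_subtopology intro!: continuous_on_Pair continuous_on_snd continuous_on_id)
  from continuous_map_compose[OF this cube_homotopyD(1)[OF assms(1) \<open>k \<ge> 1\<close>]]
  show "continuous_map (top_of_set ({0..1::real} \<times> cube n)) Y (\<lambda>(s, x). H k a x)"
    by (simp add: o_def case_prod_unfold)
next
  fix k s x assume "1 \<le> (k::nat)" "s \<in> {0..1::real}" "x \<in> cube_boundary n"
  then show "H k a x = y0" using assms by (intro cube_homotopyD(2)) auto
next
  fix U assume "openin Y U" "y0 \<in> U"
  then show "\<exists>m. \<forall>k>m. \<forall>s\<in>{0..1::real}. \<forall>x\<in>cube n. H k a x \<in> U"
    using cube_homotopyD(3)[OF assms(1)] assms(2) by meson
qed

section \<open>Representatives and the product of classes\<close>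

lemma he_class_eq_iff:
  assumes "he_based_map n Y y0 f" "he_based_map n Y y0 g"
  shows "he_class n Y y0 f = he_class n Y y0 g \<longleftrightarrow> homotopic_with (\<lambda>h. h theta = y0) (HE n) Y f g"
proof
  assume *: "he_class n Y y0 f = he_class n Y y0 g"
  have "g \<in> he_class n Y y0 g" using assms(2) by (simp add: he_class_def he_based_map_def)
  then have "g \<in> he_class n Y y0 f" by (simp only: *)
  then show "homotopic_with (\<lambda>h. h theta = y0) (HE n) Y f g" by (simp add: he_class_def)
next
  assume *: "homotopic_with (\<lambda>h. h theta = y0) (HE n) Y f g"
  show "he_class n Y y0 f = he_class n Y y0 g"
    unfolding he_class_def
    using homotopic_with_trans[OF *] homotopic_with_trans[OF homotopic_with_symD[OF *]]
    by (intro Collect_cong) blast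
qed

text \<open>The product of the group is computed on representatives picked by \<open>SOME\<close>.
  Members of a class are by definition only extensional and homotopic to f; that they are based maps
  is recovered from the homotopy.\<close>

lemma he_class_some:
  assumes "he_based_map n Y y0 f"
  shows "he_based_map n Y y0 (SOME g. g \<in> he_class n Y y0 f)"
    and "homotopic_with (\<lambda>h. h theta = y0) (HE n) Y f (SOME g. g \<in> he_class n Y y0 f)"
proof -
  have "f \<in> he_class n Y y0 f" using assms by (simp add: he_class_def he_based_map_def)
  then have *: "(SOME g. g \<in> he_class n Y y0 f) \<in> he_class n Y y0 f" by (metis someI)
  then show h: "homotopic_with (\<lambda>h. h theta = y0) (HE n) Y f (SOME g. g \<in> he_class n Y y0 f)"
    by (simp add: he_class_def)
  show "he_based_map n Y y0 (SOME g. g \<in> he_class n Y y0 f)"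
    using * homotopic_with_imp_continuous_maps[OF h] homotopic_with_imp_property[OF h]
    by (simp add: he_class_def he_based_map_def)
qed

lemma he_concat_based:
  assumes n: "n \<ge> 1" and "he_based_map n Y y0 f" "he_based_map n Y y0 g"
  shows "he_based_map n Y y0 (he_concat n y0 f g)"
    and "k \<ge> 1 \<Longrightarrow> x \<in> cube n \<Longrightarrow> he_concat n y0 f g (cube_to_sphere n k x)
      = cube_concat (\<lambda>x. f (cube_to_sphere n k x)) (\<lambda>x. g (cube_to_sphere n k x)) x"
proof -
  note c = cube_homotopy_concat[OF n he_based_map_cubes[OF n assms(2)] he_based_map_cubes[OF n assms(3)]]
  show "he_based_map n Y y0 (he_concat n y0 f g)"
    unfolding he_concat_eq_descend o_def by (rule he_based_map_descend(1)[OF n c])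
  show "he_concat n y0 f g (cube_to_sphere n k x)
      = cube_concat (\<lambda>x. f (cube_to_sphere n k x)) (\<lambda>x. g (cube_to_sphere n k x)) x"
    if "k \<ge> 1" "x \<in> cube n"
    unfolding he_concat_eq_descend o_def by (rule he_based_map_descend(2)[OF n c that])
qed

lemma he_concat_homotopic:
  assumes n: "n \<ge> 1"
    and "he_based_map n Y y0 f" "he_based_map n Y y0 g" "he_based_map n Y y0 f'" "he_based_map n Y y0 g'"
    and ff: "homotopic_with (\<lambda>h. h theta = y0) (HE n) Y f f'"
    and gg: "homotopic_with (\<lambda>h. h theta = y0) (HE n) Y g g'"
  shows "homotopic_with (\<lambda>h. h theta = y0) (HE n) Y (he_concat n y0 f g) (he_concat n y0 f' g')"
proof -
  obtain H where H: "cube_homotopy n Y y0 H" "\<And>k x. H k 0 x = f (cube_to_sphere n k x)"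
    "\<And>k x. H k 1 x = f' (cube_to_sphere n k x)" using cube_homotopy_of_homotopic[OF n ff] by metis
  obtain G where G: "cube_homotopy n Y y0 G" "\<And>k x. G k 0 x = g (cube_to_sphere n k x)"
    "\<And>k x. G k 1 x = g' (cube_to_sphere n k x)" using cube_homotopy_of_homotopic[OF n gg] by metis
  show ?thesis
  proof (rule homotopic_of_cube_homotopy[OF n cube_homotopy_concat[OF n H(1) G(1)]])
    show "he_concat n y0 f g \<in> extensional (hawaiian n)" "he_concat n y0 f' g' \<in> extensional (hawaiian n)"
      by (simp_all add: he_concat_eq_descend descend_extensional)
  next
    fix k x assume *: "1 \<le> (k::nat)" "x \<in> cube n"
    show "cube_concat (H k 0) (G k 0) x = he_concat n y0 f g (cube_to_sphere n k x)"
      unfolding he_concat_based(2)[OF n assms(2,3) *] by (simp add: cube_concat_def H G)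
    show "cube_concat (H k 1) (G k 1) x = he_concat n y0 f' g' (cube_to_sphere n k x)"
      unfolding he_concat_based(2)[OF n assms(4,5) *] by (simp add: cube_concat_def H G)
  qed
qed

text \<open>Frees the product from the chosen representatives, so that the group laws can be checked
  on any convenient ones.\<close>

lemma hawaiian_mult:
  assumes n: "n \<ge> 1" and f: "he_based_map n Y y0 f" and g: "he_based_map n Y y0 g"
  shows "he_class n Y y0 f \<otimes>\<^bsub>hawaiian_group n Y y0\<^esub> he_class n Y y0 g = he_class n Y y0 (he_concat n y0 f g)"
proof -
  note F = he_class_some[OF f] and G = he_class_some[OF g]
  have "homotopic_with (\<lambda>h. h theta = y0) (HE n) Y (he_concat n y0 f g)
      (he_concat n y0 (SOME h. h \<in> he_class n Y y0 f) (SOME h. h \<in> he_class n Y y0 g))"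
    by (rule he_concat_homotopic[OF n f g F(1) G(1) F(2) G(2)])
  then have "he_class n Y y0 (he_concat n y0 f g) = he_class n Y y0
      (he_concat n y0 (SOME h. h \<in> he_class n Y y0 f) (SOME h. h \<in> he_class n Y y0 g))"
    using he_class_eq_iff[OF he_concat_based(1)[OF n f g] he_concat_based(1)[OF n F(1) G(1)]] by simp
  then show ?thesis by (simp add: hawaiian_group_def)
qed

section \<open>The group structure\<close>

definition const_map :: "nat \<Rightarrow> 'a \<Rightarrow> (nat \<Rightarrow> real) \<Rightarrow> 'a" where
  "const_map n y0 p = (if p \<in> hawaiian n then y0 else undefined)"

lemma const_map_based:
  assumes "y0 \<in> topspace Y" shows "he_based_map n Y y0 (const_map n y0)"
proof -
  have "continuous_map (HE n) Y (const_map n y0)"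
    by (rule continuous_map_eq[of _ _ "\<lambda>_. y0"]) (use assms in \<open>simp_all add: const_map_def\<close>)
  then show ?thesis
    using theta_in_hawaiian by (simp add: he_based_map_def const_map_def extensional_def)
qed

lemma const_map_cube: "n \<ge> 1 \<Longrightarrow> k \<ge> 1 \<Longrightarrow> x \<in> cube n \<Longrightarrow> const_map n y0 (cube_to_sphere n k x) = y0"
  by (simp add: const_map_def cube_to_sphere_in)

lemma hawaiian_group_simps:
  "carrier (hawaiian_group n Y y0) = {he_class n Y y0 f | f. he_based_map n Y y0 f}"
  "\<one>\<^bsub>hawaiian_group n Y y0\<^esub> = he_class n Y y0 (const_map n y0)"
  by (simp_all add: hawaiian_group_def const_map_def[abs_def])

lemma he_class_in_carrier: "he_based_map n Y y0 f \<Longrightarrow> he_class n Y y0 f \<in> carrier (hawaiian_group n Y y0)"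
  unfolding hawaiian_group_simps by blast

lemma carrier_hawaiian_groupE:
  assumes "A \<in> carrier (hawaiian_group n Y y0)"
  obtains f where "A = he_class n Y y0 f" "he_based_map n Y y0 f"
  using assms unfolding hawaiian_group_simps by blast

lemma he_class_eqI:
  assumes n: "n \<ge> 1" and "he_based_map n Y y0 f" "he_based_map n Y y0 g"
    and H: "cube_homotopy n Y y0 H"
    and "\<And>k x. k \<ge> 1 \<Longrightarrow> x \<in> cube n \<Longrightarrow> H k 0 x = f (cube_to_sphere n k x)"
    and "\<And>k x. k \<ge> 1 \<Longrightarrow> x \<in> cube n \<Longrightarrow> H k 1 x = g (cube_to_sphere n k x)"
  shows "he_class n Y y0 f = he_class n Y y0 g"
  using assms(2,3) homotopic_of_cube_homotopy[OF n H _ _ assms(5,6)] he_class_eq_iff[OF assms(2,3)]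
  by (simp add: he_based_map_def)

text \<open>The values of \<open>he_concat\<close> are known at points coming from the cube; this
  allows rewriting with them inside a nested concatenation.\<close>

lemma cube_concat_cong:
  assumes "n \<ge> 1" "x \<in> cube n"
    and "\<And>y. y \<in> cube n \<Longrightarrow> F y = F' y" "\<And>y. y \<in> cube n \<Longrightarrow> G y = G' y"
  shows "cube_concat F G x = cube_concat F' G' x"
proof (cases "x 1 \<le> 1/2")
  case True
  then have "x(1 := 2 * x 1) \<in> cube n" using cube_components[OF assms(2), of 1] by (intro cube_update assms) simp
  then show ?thesis using True assms(3) by (simp add: cube_concat_def)
next
  case False
  then have "x(1 := 2 * x 1 - 1) \<in> cube n" using cube_components[OF assms(2), of 1] by (intro cube_update assms) simp
  then show ?thesis using False assms(4) by (simp add: cube_concat_def)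
qed

text \<open>The concave piecewise linear reparametrisation with slopes 2, 1 and 1/2.\<close>

lemma cube_concat_assoc:
  "cube_concat (cube_concat F G) K x
     = cube_concat F (cube_concat G K) (x(1 := min (2 * x 1) (min (x 1 + 1/4) ((x 1 + 1) / 2))))"
proof -
  consider "x 1 \<le> 1/4" | "1/4 < x 1" "x 1 \<le> 1/2" | "1/2 < x 1" by linarith
  then show ?thesis
  proof cases
    case 1
    then have "min (2 * x 1) (min (x 1 + 1/4) ((x 1 + 1) / 2)) = 2 * x 1" by (simp add: min_def)
    then show ?thesis using 1 by (simp add: cube_concat_def)
  next
    case 2
    then have "min (2 * x 1) (min (x 1 + 1/4) ((x 1 + 1) / 2)) = x 1 + 1/4" by (simp add: min_def)
    then show ?thesis using 2 by (simp add: cube_concat_def)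
  next
    case 3
    then have "min (2 * x 1) (min (x 1 + 1/4) ((x 1 + 1) / 2)) = (x 1 + 1) / 2" by (simp add: min_def)
    then show ?thesis using 3 by (simp add: cube_concat_def add_divide_distrib)
  qed
qed

text \<open>On every sphere the two bracketings differ by the same reparametrisation of the first
  coordinate; interpolating linearly between it (s = 0) and the identity (s = 1) gives the
  homotopy.\<close>

lemma he_concat_assoc:
  assumes n: "n \<ge> 1"
    and f: "he_based_map n Y y0 f" and g: "he_based_map n Y y0 g" and h: "he_based_map n Y y0 h"
  shows "he_class n Y y0 (he_concat n y0 (he_concat n y0 f g) h)
       = he_class n Y y0 (he_concat n y0 f (he_concat n y0 g h))"
proof -
  define \<tau> where "\<tau> = (\<lambda>s u :: real. (1 - s) * min (2 * u) (min (u + 1/4) ((u + 1) / 2)) + s * u)"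
  note fg = he_concat_based[OF n f g] and gh = he_concat_based[OF n g h]
  note fgh1 = he_concat_based[OF n fg(1) h] and fgh2 = he_concat_based[OF n f gh(1)]
  have i: "\<tau> s u \<in> {0..1}" if "s \<in> {0..1}" "u \<in> {0..1}" for s u
  proof -
    have "min (2 * u) (min (u + 1/4) ((u + 1) / 2)) \<in> {0..1}" using that by (auto simp: min_def)
    then show ?thesis unfolding \<tau>_def
      using that convex_bound_le[of "min (2 * u) (min (u + 1/4) ((u + 1) / 2))" 1 u "1 - s" s] by simp
  qed
  have H: "cube_homotopy n Y y0
      (\<lambda>k s x. he_concat n y0 f (he_concat n y0 g h) (cube_to_sphere n k (x(1 := \<tau> s (x 1)))))"
  proof (rule cube_homotopy_reparam[OF n he_based_map_cubes[OF n fgh2(1)]])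
    show "continuous_on ({0..1} \<times> {0..1}) (\<lambda>(s, u). \<tau> s u)"
      unfolding \<tau>_def case_prod_unfold by (intro continuous_intros) auto
  qed (use i in \<open>auto simp: \<tau>_def\<close>)
  show ?thesis
  proof (rule he_class_eqI[OF n fgh1(1) fgh2(1) H])
    fix k x assume k: "1 \<le> (k::nat)" and x: "x \<in> cube n"
    let ?F = "\<lambda>x. f (cube_to_sphere n k x)" and ?G = "\<lambda>x. g (cube_to_sphere n k x)"
      and ?H = "\<lambda>x. h (cube_to_sphere n k x)"
    have "x 1 \<in> {0..1}" using cube_components[OF x] by simp
    then have t: "x(1 := \<tau> 0 (x 1)) \<in> cube n" by (intro cube_update[OF x n] i) auto
    have "he_concat n y0 f (he_concat n y0 g h) (cube_to_sphere n k (x(1 := \<tau> 0 (x 1))))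
        = cube_concat ?F (cube_concat ?G ?H) (x(1 := \<tau> 0 (x 1)))"
      unfolding fgh2(2)[OF k t] by (rule cube_concat_cong[OF n t refl gh(2)[OF k]])
    also have "\<dots> = cube_concat (cube_concat ?F ?G) ?H x"
      unfolding cube_concat_assoc by (simp add: \<tau>_def)
    also have "\<dots> = he_concat n y0 (he_concat n y0 f g) h (cube_to_sphere n k x)"
      unfolding fgh1(2)[OF k x] by (rule cube_concat_cong[OF n x fg(2)[OF k, symmetric] refl])
    finally show "he_concat n y0 f (he_concat n y0 g h) (cube_to_sphere n k (x(1 := \<tau> 0 (x 1))))
        = he_concat n y0 (he_concat n y0 f g) h (cube_to_sphere n k x)" .
    show "he_concat n y0 f (he_concat n y0 g h) (cube_to_sphere n k (x(1 := \<tau> 1 (x 1))))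
        = he_concat n y0 f (he_concat n y0 g h) (cube_to_sphere n k x)"
      by (simp add: \<tau>_def)
  qed
qed

lemma based_map_at_cube_boundary:
  assumes "n \<ge> 1" "he_based_map n Y y0 f" "k \<ge> 1" "x \<in> cube n" "u \<in> {0, 1}"
  shows "f (cube_to_sphere n k (x(1 := u))) = y0"
proof -
  have "x(1 := u) \<in> cube_boundary n"
    using assms cube_update[of x n u] by (auto simp: cube_boundary_def)
  then show ?thesis
    using cube_homotopyD(2)[OF he_based_map_cubes[OF assms(1,2)] assms(3), of 0] by simp
qed

lemma he_concat_const_left:
  assumes n: "n \<ge> 1" and y: "y0 \<in> topspace Y" and f: "he_based_map n Y y0 f"
  shows "he_class n Y y0 (he_concat n y0 (const_map n y0) f) = he_class n Y y0 f"
proof -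
  \<comment> \<open>At s = 0 the first half of the interval is collapsed to 0, a face on which f has
    the value \<open>y0\<close>; this is the constant map followed by f.\<close>
  define \<tau> where "\<tau> = (\<lambda>s u :: real. (1 - s) * max 0 (2 * u - 1) + s * u)"
  note cf = he_concat_based[OF n const_map_based[OF y] f]
  have i: "\<tau> s u \<in> {0..1}" if "s \<in> {0..1}" "u \<in> {0..1}" for s u
    unfolding \<tau>_def using that convex_bound_le[of "max 0 (2 * u - 1)" 1 u "1 - s" s] by simp
  have H: "cube_homotopy n Y y0 (\<lambda>k s x. f (cube_to_sphere n k (x(1 := \<tau> s (x 1)))))"
  proof (rule cube_homotopy_reparam[OF n he_based_map_cubes[OF n f]])
    show "continuous_on ({0..1} \<times> {0..1}) (\<lambda>(s, u). \<tau> s u)"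
      unfolding \<tau>_def case_prod_unfold by (intro continuous_intros)
  qed (use i in \<open>auto simp: \<tau>_def\<close>)
  show ?thesis
  proof (rule he_class_eqI[OF n cf(1) f H])
    fix k x assume k: "1 \<le> (k::nat)" and x: "x \<in> cube n"
    have c: "x(1 := 2 * x 1) \<in> cube n" if "x 1 \<le> 1/2"
      using that cube_components[OF x, of 1] by (intro cube_update[OF x n]) simp
    show "f (cube_to_sphere n k (x(1 := \<tau> 0 (x 1)))) = he_concat n y0 (const_map n y0) f (cube_to_sphere n k x)"
    proof (cases "x 1 \<le> 1/2")
      case True
      then have "\<tau> 0 (x 1) = 0" by (simp add: \<tau>_def)
      then show ?thesis
        unfolding cf(2)[OF k x] cube_concat_def const_map_cube[OF n k c[OF True]]
        using True based_map_at_cube_boundary[OF n f k x, of 0] by simp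
    next
      case False
      then have "\<tau> 0 (x 1) = 2 * x 1 - 1" by (simp add: \<tau>_def)
      then show ?thesis
        unfolding cf(2)[OF k x] cube_concat_def using False by simp
    qed
    show "f (cube_to_sphere n k (x(1 := \<tau> 1 (x 1)))) = f (cube_to_sphere n k x)"
      by (simp add: \<tau>_def)
  qed
qed

text \<open>The inverse is f with the first coordinate reversed, so the product takes at u the value
  of f at |1 - 2u|, an excursion from the face 1 to the face 0 and back.\<close>

lemma he_concat_left_inverse:
  assumes n: "n \<ge> 1" and y: "y0 \<in> topspace Y" and f: "he_based_map n Y y0 f"
  obtains g where "he_based_map n Y y0 g"
    "he_class n Y y0 (he_concat n y0 g f) = he_class n Y y0 (const_map n y0)"
proof -
  define g where "g = descend n y0 (\<lambda>k x. f (cube_to_sphere n k (x(1 := 1 - x 1))))"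
  have "cube_homotopy n Y y0 (\<lambda>k s x. f (cube_to_sphere n k (x(1 := (\<lambda>s u. 1 - u) s (x 1)))))"
    by (rule cube_homotopy_reparam[OF n he_based_map_cubes[OF n f]])
       (auto simp: case_prod_unfold intro!: continuous_intros)
  then have G: "cube_homotopy n Y y0 (\<lambda>k s x. f (cube_to_sphere n k (x(1 := 1 - x 1))))" by simp
  note g = he_based_map_descend[OF n G, folded g_def]
  note gf = he_concat_based[OF n g(1) f]
  \<comment> \<open>The excursion is cut off at level s; at s = 1 only the face 1 is left, where f
    is \<open>y0\<close>.\<close>
  define \<tau> where "\<tau> = (\<lambda>s u :: real. max s \<bar>1 - 2 * u\<bar>)"
  have H: "cube_homotopy n Y y0 (\<lambda>k s x. f (cube_to_sphere n k (x(1 := \<tau> s (x 1)))))"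
  proof (rule cube_homotopy_reparam[OF n he_based_map_cubes[OF n f]])
    show "continuous_on ({0..1} \<times> {0..1}) (\<lambda>(s, u). \<tau> s u)"
      unfolding \<tau>_def case_prod_unfold by (intro continuous_intros)
  qed (auto simp: \<tau>_def)
  have "he_class n Y y0 (he_concat n y0 g f) = he_class n Y y0 (const_map n y0)"
  proof (rule he_class_eqI[OF n gf(1) const_map_based[OF y] H])
    fix k x assume k: "1 \<le> (k::nat)" and x: "x \<in> cube n"
    have c: "x(1 := 2 * x 1) \<in> cube n" if "x 1 \<le> 1/2"
      using that cube_components[OF x, of 1] by (intro cube_update[OF x n]) simp
    show "f (cube_to_sphere n k (x(1 := \<tau> 0 (x 1)))) = he_concat n y0 g f (cube_to_sphere n k x)"
    proof (cases "x 1 \<le> 1/2")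
      case True
      then show ?thesis
        unfolding gf(2)[OF k x] using g(2)[OF k c[OF True]] by (simp add: cube_concat_def \<tau>_def)
    next
      case False
      then show ?thesis
        unfolding gf(2)[OF k x] by (simp add: cube_concat_def \<tau>_def)
    qed
    have "\<tau> 1 (x 1) = 1" using cube_components[OF x, of 1] by (simp add: \<tau>_def abs_if)
    then show "f (cube_to_sphere n k (x(1 := \<tau> 1 (x 1)))) = const_map n y0 (cube_to_sphere n k x)"
      using based_map_at_cube_boundary[OF n f k x, of 1] unfolding const_map_cube[OF n k x] by simp
  qed
  then show thesis using that g(1) by blast
qed

text \<open>\<open>groupI\<close> asks for a left unit and left inverses only, hence the one-sided
  lemmas above.\<close>

lemma group_hawaiian_group:
  assumes n: "n \<ge> 1" and y: "y0 \<in> topspace Y"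
  shows "group (hawaiian_group n Y y0)" (is "group ?G")
proof (rule groupI)
  fix A B assume "A \<in> carrier ?G" "B \<in> carrier ?G"
  then obtain f g where fg: "A = he_class n Y y0 f" "he_based_map n Y y0 f"
    "B = he_class n Y y0 g" "he_based_map n Y y0 g"
    by (elim carrier_hawaiian_groupE)
  show "A \<otimes>\<^bsub>?G\<^esub> B \<in> carrier ?G"
    unfolding fg hawaiian_mult[OF n fg(2,4)]
    by (rule he_class_in_carrier[OF he_concat_based(1)[OF n fg(2,4)]])
next
  show "\<one>\<^bsub>?G\<^esub> \<in> carrier ?G"
    unfolding hawaiian_group_simps(2) by (rule he_class_in_carrier[OF const_map_based[OF y]])
next
  fix A B C assume "A \<in> carrier ?G" "B \<in> carrier ?G" "C \<in> carrier ?G"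
  then obtain f g h where f: "A = he_class n Y y0 f" "he_based_map n Y y0 f"
    and g: "B = he_class n Y y0 g" "he_based_map n Y y0 g"
    and h: "C = he_class n Y y0 h" "he_based_map n Y y0 h"
    by (elim carrier_hawaiian_groupE)
  show "A \<otimes>\<^bsub>?G\<^esub> B \<otimes>\<^bsub>?G\<^esub> C = A \<otimes>\<^bsub>?G\<^esub> (B \<otimes>\<^bsub>?G\<^esub> C)"
    unfolding f(1) g(1) h(1) hawaiian_mult[OF n f(2) g(2)] hawaiian_mult[OF n g(2) h(2)]
      hawaiian_mult[OF n he_concat_based(1)[OF n f(2) g(2)] h(2)]
      hawaiian_mult[OF n f(2) he_concat_based(1)[OF n g(2) h(2)]]
    by (rule he_concat_assoc[OF n f(2) g(2) h(2)])
next
  fix A assume "A \<in> carrier ?G"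
  then obtain f where f: "A = he_class n Y y0 f" "he_based_map n Y y0 f"
    by (elim carrier_hawaiian_groupE)
  show "\<one>\<^bsub>?G\<^esub> \<otimes>\<^bsub>?G\<^esub> A = A"
    unfolding f(1) hawaiian_group_simps(2) hawaiian_mult[OF n const_map_based[OF y] f(2)]
    by (rule he_concat_const_left[OF n y f(2)])
  obtain g where g: "he_based_map n Y y0 g"
    "he_class n Y y0 (he_concat n y0 g f) = he_class n Y y0 (const_map n y0)"
    by (rule he_concat_left_inverse[OF n y f(2)])
  have "he_class n Y y0 g \<otimes>\<^bsub>?G\<^esub> A = \<one>\<^bsub>?G\<^esub>"
    unfolding f(1) hawaiian_group_simps(2) hawaiian_mult[OF n g(1) f(2)] by (rule g(2))
  then show "\<exists>B\<in>carrier ?G. B \<otimes>\<^bsub>?G\<^esub> A = \<one>\<^bsub>?G\<^esub>"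
    using he_class_in_carrier[OF g(1)] by (rule bexI)
qed

section \<open>The cone\<close>

abbreviation unit_interval :: "real topology" where
  "unit_interval \<equiv> top_of_set {0..1}"

lemma openin_cone_top: "openin (cone_top X) U \<longleftrightarrow> cone_open X U"
  by (simp add: cone_top_def topology_inverse'[OF istopology_cone_open])

lemma topspace_cone_top: "topspace (cone_top X) = cone_proj ` (topspace X \<times> {0..1})"
proof
  show "topspace (cone_top X) \<subseteq> cone_proj ` (topspace X \<times> {0..1})"
    using openin_topspace[of "cone_top X"] unfolding openin_cone_top cone_open_def by blast
  have "{z \<in> topspace X \<times> {0..1::real}. cone_proj z \<in> cone_proj ` (topspace X \<times> {0..1})} = topspace X \<times> {0..1}"
    by blast
  moreover have "openin (prod_topology X unit_interval) (topspace X \<times> {0..1})"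
    using openin_topspace[of "prod_topology X unit_interval"] by simp
  ultimately have "openin (cone_top X) (cone_proj ` (topspace X \<times> {0..1}))"
    unfolding openin_cone_top cone_open_def by simp
  then show "cone_proj ` (topspace X \<times> {0..1}) \<subseteq> topspace (cone_top X)"
    by (rule openin_subset)
qed

lemma quotient_map_cone_proj: "quotient_map (prod_topology X unit_interval) (cone_top X) cone_proj"
  unfolding quotient_map_def
proof (intro conjI allI impI)
  show "cone_proj ` topspace (prod_topology X unit_interval) = topspace (cone_top X)"
    by (simp add: topspace_cone_top)
  fix U assume "U \<subseteq> topspace (cone_top X)"
  then show "openin (prod_topology X unit_interval) {z \<in> topspace (prod_topology X unit_interval). cone_proj z \<in> U}
      = openin (cone_top X) U"
    by (simp add: openin_cone_top cone_open_def topspace_cone_top)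
qed

lemma cone_top_cases:
  assumes "z \<in> topspace (cone_top X)" "z \<noteq> None"
  obtains a h where "z = Some (a, h)" "a \<in> topspace X" "0 \<le> h" "h < 1"
  using assms by (auto simp: topspace_cone_top cone_proj_def split: if_splits)

text \<open>Below the vertex \<open>cone_proj\<close> is injective, so the box is its own preimage;
  the heights are cut to \<open>{0..<1}\<close> to keep the vertex out.\<close>

lemma openin_cone_top_box:
  assumes "openin X V" "open W"
  shows "openin (cone_top X) (Some ` (V \<times> (W \<inter> {0..<1})))"
  unfolding openin_cone_top cone_open_def
proof
  have V: "V \<subseteq> topspace X" using assms(1) by (rule openin_subset)
  have S: "Some (a, h) = cone_proj (a, h)" if "h < 1" for a :: 'a and h :: real
    using that by (simp add: cone_proj_def)
  show "Some ` (V \<times> (W \<inter> {0..<1})) \<subseteq> cone_proj ` (topspace X \<times> {0..1})"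
    using V by (force simp: S)
  have "{z \<in> topspace X \<times> {0..1}. cone_proj z \<in> Some ` (V \<times> (W \<inter> {0..<1}))} = V \<times> ({0..1} \<inter> (W \<inter> {..<1}))"
    using V by (auto simp: cone_proj_def image_iff split: if_splits)
  moreover have "openin unit_interval ({0..1} \<inter> (W \<inter> {..<1}))"
    using assms(2) by (intro openin_open_Int open_Int open_lessThan)
  ultimately show "openin (prod_topology X unit_interval)
      {z \<in> topspace X \<times> {0..1}. cone_proj z \<in> Some ` (V \<times> (W \<inter> {0..<1}))}"
    using assms(1) by (simp add: openin_prod_Times_iff)
qed

text \<open>Off the vertex the cone is X \<times> [0,1), and the preimage of an open set of either
  factor is the preimage of an open box.\<close>

lemma cone_coordinates_continuous:
  assumes f: "continuous_map T (cone_top X) f" and v: "\<And>x. x \<in> topspace T \<Longrightarrow> f x \<noteq> None"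
  shows "continuous_map T X (\<lambda>x. fst (the (f x)))"
    and "continuous_map T euclideanreal (\<lambda>x. snd (the (f x)))"
proof -
  have c: "\<exists>a h. f x = Some (a, h) \<and> a \<in> topspace X \<and> 0 \<le> h \<and> h < 1" if "x \<in> topspace T" for x
    using cone_top_cases[OF funcset_mem[OF continuous_map_funspace[OF f] that] v[OF that]] by blast
  have pre: "openin T {x \<in> topspace T. f x \<in> Some ` (V \<times> (W \<inter> {0..<1}))}" if "openin X V" "open W" for V W
    by (rule openin_continuous_map_preimage[OF f openin_cone_top_box[OF that]])
  show "continuous_map T X (\<lambda>x. fst (the (f x)))"
    unfolding continuous_map_def
  proof (intro conjI allI impI funcsetI)
    fix x assume "x \<in> topspace T" then show "fst (the (f x)) \<in> topspace X" using c[of x] by auto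
  next
    fix V assume V: "openin X V"
    have "{x \<in> topspace T. f x \<in> Some ` (V \<times> (UNIV \<inter> {0..<1}))} = {x \<in> topspace T. fst (the (f x)) \<in> V}"
    proof (intro Collect_cong conj_cong refl)
      fix x assume "x \<in> topspace T"
      then show "f x \<in> Some ` (V \<times> (UNIV \<inter> {0..<1})) \<longleftrightarrow> fst (the (f x)) \<in> V" using c[of x] by auto
    qed
    then show "openin T {x \<in> topspace T. fst (the (f x)) \<in> V}" using pre[OF V open_UNIV] by simp
  qed
  show "continuous_map T euclideanreal (\<lambda>x. snd (the (f x)))"
    unfolding continuous_map_def
  proof (intro conjI allI impI funcsetI)
    fix W :: "real set" assume "openin euclidean W"
    then have W: "open W" by simp
    have "{x \<in> topspace T. f x \<in> Some ` (topspace X \<times> (W \<inter> {0..<1}))} = {x \<in> topspace T. snd (the (f x)) \<in> W}"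
    proof (intro Collect_cong conj_cong refl)
      fix x assume "x \<in> topspace T"
      then show "f x \<in> Some ` (topspace X \<times> (W \<inter> {0..<1})) \<longleftrightarrow> snd (the (f x)) \<in> W" using c[of x] by auto
    qed
    then show "openin T {x \<in> topspace T. snd (the (f x)) \<in> W}" using pre[OF openin_topspace W] by simp
  qed simp
qed

lemma continuous_map_cone_proj:
  assumes "continuous_map T X a" "continuous_map T euclideanreal h"
    and "\<And>x. x \<in> topspace T \<Longrightarrow> h x \<in> {0..1}"
  shows "continuous_map T (cone_top X) (\<lambda>x. cone_proj (a x, h x))"
proof -
  have "continuous_map T unit_interval h"
    using assms(2,3) by (auto simp: continuous_map_in_subtopology)
  then have "continuous_map T (prod_topology X unit_interval) (\<lambda>x. (a x, h x))"
    using assms(1) by (simp add: continuous_map_pairwise o_def)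
  from continuous_map_compose[OF this quotient_imp_continuous_map[OF quotient_map_cone_proj]]
  show ?thesis by (simp add: o_def)
qed

text \<open>Slides a point along its cone line by the fraction a of the way left to the vertex; the
  outer \<open>cone_proj\<close> turns height 1 into \<open>None\<close>.\<close>

definition cone_push :: "('a \<times> real) option \<Rightarrow> real \<Rightarrow> ('a \<times> real) option" where
  "cone_push z a = (case z of None \<Rightarrow> None | Some (x, h) \<Rightarrow> cone_proj (x, h + a * (1 - h)))"

lemma cone_push_proj: "cone_push (cone_proj w) a = cone_proj (fst w, snd w + a * (1 - snd w))"
  by (cases w) (simp add: cone_push_def cone_proj_def)

text \<open>Membership in the cone matters: \<open>Some (a, 1)\<close> is not a point of it and
  would be sent to \<open>None\<close>.\<close>

lemma cone_push_0: "z \<in> topspace (cone_top X) \<Longrightarrow> cone_push z 0 = z"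
  by (auto simp: topspace_cone_top cone_push_proj)

lemma cone_push_1: "cone_push z 1 = None"
  by (auto simp: cone_push_def cone_proj_def split: option.split)

text \<open>Since the unit interval is locally compact, the product of the quotient map defining the cone with
  the identity of the interval is again a quotient map.\<close>

lemma continuous_map_cone_push:
  "continuous_map (prod_topology (cone_top X) unit_interval) (cone_top X) (\<lambda>(z, a). cone_push z a)"
proof -
  let ?P = "prod_topology X unit_interval"
  have "locally_compact_space unit_interval"
    by (intro compact_imp_locally_compact_space) (simp_all add: compact_space_subtopology)
  moreover have "Hausdorff_space unit_interval"
    by (simp add: Hausdorff_space_subtopology)
  ultimately have q: "quotient_map (prod_topology ?P unit_interval) (prod_topology (cone_top X) unit_interval)
      (\<lambda>(z, a). (cone_proj z, a))"
    using quotient_map_prod_left quotient_map_cone_proj by blast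
  have f: "continuous_map (prod_topology ?P unit_interval) X (\<lambda>w. fst (fst w))"
    using continuous_map_compose[OF continuous_map_fst continuous_map_fst] by (simp add: o_def)
  have h: "continuous_map (prod_topology ?P unit_interval) euclideanreal (\<lambda>w. snd (fst w))"
    using continuous_map_compose[OF continuous_map_fst[of ?P unit_interval] continuous_map_snd[of X unit_interval]]
    by (simp add: o_def continuous_map_in_subtopology)
  have a: "continuous_map (prod_topology ?P unit_interval) euclideanreal (\<lambda>w. snd w)"
    using continuous_map_snd[of ?P unit_interval] by (simp add: continuous_map_in_subtopology o_def)
  have b: "h + a * (1 - h) \<in> {0..1}" if "h \<in> {0..1}" "a \<in> {0..1}" for a h :: real
    using that mult_left_le_one_le[of "1 - h" a] by auto
  have "continuous_map (prod_topology ?P unit_interval) (cone_top X)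
      (\<lambda>w. cone_proj (fst (fst w), snd (fst w) + snd w * (1 - snd (fst w))))"
    by (intro continuous_map_cone_proj f continuous_map_add continuous_map_real_mult continuous_map_diff
        h a continuous_map_const[THEN iffD2] b) auto
  then have "continuous_map (prod_topology ?P unit_interval) (cone_top X)
      ((\<lambda>(z, a). cone_push z a) \<circ> (\<lambda>(z, a). (cone_proj z, a)))"
    by (simp add: o_def case_prod_unfold cone_push_proj)
  then show ?thesis
    using continuous_compose_quotient_map_eq[OF q] by blast
qed

section \<open>Contracting and projecting in the cone\<close>

text \<open>The way to change representatives: a homotopy that starts at f is prescribed on the
  cubes, and its end descends to a based map in the class of f.\<close>

lemma deform_based_map:
  assumes n: "n \<ge> 1" and f: "he_based_map n Y y0 f" and H: "cube_homotopy n Y y0 H"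
    and H0: "\<And>k x. k \<ge> 1 \<Longrightarrow> x \<in> cube n \<Longrightarrow> H k 0 x = f (cube_to_sphere n k x)"
  obtains f' where "he_based_map n Y y0 f'" "he_class n Y y0 f = he_class n Y y0 f'"
    "\<And>k x. k \<ge> 1 \<Longrightarrow> x \<in> cube n \<Longrightarrow> f' (cube_to_sphere n k x) = H k 1 x"
proof -
  have "cube_homotopy n Y y0 (\<lambda>k s. H k 1)" by (rule cube_homotopy_at[OF H]) simp
  note f' = he_based_map_descend[OF n this]
  show thesis
    by (rule that[OF f'(1) he_class_eqI[OF n f f'(1) H H0] f'(2)]) (simp_all add: f'(2))
qed

text \<open>Smallness concerns late spheres only, so on the first m of them any continuous homotopy
  rel boundary is allowed, even one through the vertex.\<close>

lemma cube_homotopy_finite_modification: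
  assumes G: "cube_homotopy n Y y0 G"
    and "\<And>k. k \<ge> 1 \<Longrightarrow> k \<le> m \<Longrightarrow> continuous_map (top_of_set ({0..1} \<times> cube n)) Y (\<lambda>(s, x). K k s x)"
    and "\<And>k s x. k \<ge> 1 \<Longrightarrow> k \<le> m \<Longrightarrow> s \<in> {0..1} \<Longrightarrow> x \<in> cube_boundary n \<Longrightarrow> K k s x = y0"
  shows "cube_homotopy n Y y0 (\<lambda>k s x. if k \<le> m then K k s x else G k s x)"
proof (rule cube_homotopyI)
  fix k :: nat assume "k \<ge> 1"
  then show "continuous_map (top_of_set ({0..1} \<times> cube n)) Y (\<lambda>(s, x). if k \<le> m then K k s x else G k s x)"
    using assms(2) cube_homotopyD(1)[OF G] by (cases "k \<le> m") auto
next
  fix k s x assume "1 \<le> (k::nat)" "s \<in> {0..1::real}" "x \<in> cube_boundary n"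
  then show "(if k \<le> m then K k s x else G k s x) = y0"
    using assms(3) cube_homotopyD(2)[OF G] by simp
next
  fix U assume "openin Y U" "y0 \<in> U"
  then obtain l where "\<forall>k>l. \<forall>s\<in>{0..1}. \<forall>x\<in>cube n. G k s x \<in> U"
    using cube_homotopyD(3)[OF G] by blast
  then show "\<exists>m'. \<forall>k>m'. \<forall>s\<in>{0..1}. \<forall>x\<in>cube n. (if k \<le> m then K k s x else G k s x) \<in> U"
    by (intro exI[of _ "max l m"]) simp
qed

text \<open>Magnifies the cube about its centre by 1 + s and clips the overflow onto the boundary:
  boundary points stay there, and a collar is gradually absorbed into the boundary.\<close>

definition clamp_scale :: "nat \<Rightarrow> real \<Rightarrow> (nat \<Rightarrow> real) \<Rightarrow> nat \<Rightarrow> real" where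
  "clamp_scale n s x = (\<lambda>i. if i \<in> {1..n} then max 0 (min 1 (1/2 + (1 + s) * (x i - 1/2))) else 0)"

lemma clamp_scale_cube: "clamp_scale n s x \<in> cube n"
  by (auto simp: clamp_scale_def cube_def)

lemma clamp_scale_0: "x \<in> cube n \<Longrightarrow> clamp_scale n 0 x = x"
  by (rule ext) (auto simp: clamp_scale_def cube_def)

lemma clamp_scale_boundary:
  assumes "s \<in> {0..1}" "x \<in> cube_boundary n" shows "clamp_scale n s x \<in> cube_boundary n"
proof -
  obtain i where "i \<in> {1..n}" "x i = 0 \<or> x i = 1" using assms(2) by (auto simp: cube_boundary_def)
  then have "clamp_scale n s x i = 0 \<or> clamp_scale n s x i = 1"
    using assms(1) by (auto simp: clamp_scale_def max_def min_def field_simps)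
  then show ?thesis using \<open>i \<in> {1..n}\<close> clamp_scale_cube by (auto simp: cube_boundary_def)
qed

lemma continuous_on_cube_component:
  "continuous_on (S \<times> T) (\<lambda>z. snd z i :: real)"
  by (rule continuous_on_component[OF continuous_on_snd[OF continuous_on_id]])

lemma continuous_on_clamp_scale: "continuous_on (S \<times> T) (\<lambda>(s, x). clamp_scale n s x)"
proof (rule continuous_on_coordinatewise_then_product)
  fix i
  have "continuous_on (S \<times> T) (\<lambda>z. max 0 (min 1 (1/2 + (1 + fst z) * (snd z i - 1/2))))"
    by (intro continuous_on_max continuous_on_min continuous_on_const continuous_on_add continuous_on_mult
        continuous_on_diff continuous_on_fst continuous_on_id continuous_on_cube_component)
  then show "continuous_on (S \<times> T) (\<lambda>z. (case z of (s, x) \<Rightarrow> clamp_scale n s x) i)"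
    by (cases "i \<in> {1..n}") (simp_all only: clamp_scale_def case_prod_unfold if_True if_False continuous_on_const)
qed

text \<open>A plateau function: 0 on the boundary, 1 on the inner cube [1/4, 3/4]^n.\<close>

definition bump :: "nat \<Rightarrow> (nat \<Rightarrow> real) \<Rightarrow> real" where
  "bump n x = (\<Prod>i=1..n. min 1 (4 * min (x i) (1 - x i)))"

lemma bump_range: "x \<in> cube n \<Longrightarrow> bump n x \<in> {0..1}"
  unfolding bump_def by (auto intro!: prod_nonneg prod_le_1 simp: cube_components)

lemma bump_boundary: "x \<in> cube_boundary n \<Longrightarrow> bump n x = 0"
  unfolding bump_def by (intro prod_zero) (auto simp: cube_boundary_def intro: rev_bexI)

lemma continuous_on_bump: "continuous_on (S \<times> T) (\<lambda>z. bump n (snd z))"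
  unfolding bump_def
  by (intro continuous_on_prod continuous_on_min continuous_on_const continuous_on_mult
      continuous_on_diff continuous_on_cube_component)

text \<open>The constants are matched: the magnification 2 at s = 1 clips exactly what lies outside
  [1/4, 3/4] in some coordinate (up to the edge), and the slope 4 makes \<open>bump\<close> equal to
  1 on the rest.\<close>

lemma bump_or_clamp_boundary:
  assumes "x \<in> cube n" shows "bump n x = 1 \<or> clamp_scale n 1 x \<in> cube_boundary n"
proof (cases "\<forall>i\<in>{1..n}. 1/4 \<le> x i \<and> x i \<le> 3/4")
  case True
  then have "bump n x = 1" unfolding bump_def by (intro prod.neutral) (auto simp: min_def)
  then show ?thesis ..
next
  case False
  then obtain i where i: "i \<in> {1..n}" "x i < 1/4 \<or> x i > 3/4" by auto
  then have "clamp_scale n 1 x i = 0 \<or> clamp_scale n 1 x i = 1"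
    by (auto simp: clamp_scale_def)
  then show ?thesis using i clamp_scale_cube by (auto simp: cube_boundary_def)
qed

lemma continuous_map_cube_push:
  assumes "continuous_map (top_of_set ({0..1} \<times> cube n)) (cone_top X) F"
    and "continuous_on ({0..1} \<times> cube n) a" "\<And>z. z \<in> {0..1} \<times> cube n \<Longrightarrow> a z \<in> {0..1}"
  shows "continuous_map (top_of_set ({0..1} \<times> cube n)) (cone_top X) (\<lambda>z. cone_push (F z) (a z))"
proof -
  have "continuous_map (top_of_set ({0..1} \<times> cube n)) unit_interval a"
    using assms(2,3) by (auto simp: continuous_map_in_subtopology)
  then have "continuous_map (top_of_set ({0..1} \<times> cube n)) (prod_topology (cone_top X) unit_interval) (\<lambda>z. (F z, a z))"
    using assms(1) by (simp add: continuous_map_pairwise o_def)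
  from continuous_map_compose[OF this continuous_map_cone_push]
  show ?thesis by (simp add: o_def)
qed

text \<open>Contracting finitely many spheres in the cone: first make the map constant near the boundary of the
  cube, then push the inner part to the vertex; what remains only depends on the distance to the
  boundary and is pulled back along the line through the base point.\<close>

lemma cone_contract_finitely_many_spheres:
  assumes n: "n \<ge> 1" and f: "he_based_map n (cone_top X) y f"
  obtains f' where "he_based_map n (cone_top X) y f'"
    "he_class n (cone_top X) y f = he_class n (cone_top X) y f'"
    "\<And>k x. k \<ge> 1 \<Longrightarrow> k \<le> m \<Longrightarrow> x \<in> cube n \<Longrightarrow> f' (cube_to_sphere n k x) = y"
    "\<And>k x. k > m \<Longrightarrow> x \<in> cube n \<Longrightarrow> f' (cube_to_sphere n k x) = f (cube_to_sphere n k x)"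
proof -
  let ?C = "cone_top X" and ?c = "cube_to_sphere n"
  have y: "y \<in> topspace ?C"
    using f funcset_mem[OF continuous_map_funspace, of "HE n" ?C f theta] theta_in_hawaiian
    by (auto simp: he_based_map_def)
  note F = he_based_map_cubes[OF n f]
  have P: "cube_homotopy n ?C y (\<lambda>k s x. f (?c k (clamp_scale n s x)))"
    by (rule cube_homotopy_pullback[OF F continuous_on_clamp_scale clamp_scale_cube clamp_scale_boundary])
  have H1: "cube_homotopy n ?C y (\<lambda>k s x. if k \<le> m then f (?c k (clamp_scale n s x)) else f (?c k x))"
    by (rule cube_homotopy_finite_modification[OF F cube_homotopyD(1)[OF P] cube_homotopyD(2)[OF P]])
  obtain f1 where f1: "he_based_map n ?C y f1" "he_class n ?C y f = he_class n ?C y f1"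
    "\<And>k x. k \<ge> 1 \<Longrightarrow> x \<in> cube n \<Longrightarrow> f1 (?c k x) = (if k \<le> m then f (?c k (clamp_scale n 1 x)) else f (?c k x))"
    by (rule deform_based_map[OF n f H1]) (simp_all add: clamp_scale_0)
  note F1 = he_based_map_cubes[OF n f1(1)]
  have sb: "s * bump n x \<in> {0..1}" if "s \<in> {0..1}" "x \<in> cube n" for s x
    using bump_range[OF that(2)] that(1) by (auto intro: mult_le_one)
  have H2: "cube_homotopy n ?C y (\<lambda>k s x. if k \<le> m then cone_push (f1 (?c k x)) (s * bump n x) else f1 (?c k x))"
  proof (rule cube_homotopy_finite_modification[OF F1])
    fix k :: nat assume "k \<ge> 1"
    have "continuous_map (top_of_set ({0..1} \<times> cube n)) ?C
        (\<lambda>z. cone_push ((\<lambda>(s, x). f1 (?c k x)) z) (fst z * bump n (snd z)))"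
      by (rule continuous_map_cube_push[OF cube_homotopyD(1)[OF F1 \<open>k \<ge> 1\<close>]])
         (auto intro!: continuous_on_mult continuous_on_fst continuous_on_id continuous_on_bump sb simp del: atLeastAtMost_iff)
    then show "continuous_map (top_of_set ({0..1} \<times> cube n)) ?C (\<lambda>(s, x). cone_push (f1 (?c k x)) (s * bump n x))"
      by (simp add: case_prod_unfold)
  next
    fix k s x assume "1 \<le> (k::nat)" "s \<in> {0..1::real}" "x \<in> cube_boundary n"
    then have "f1 (?c k x) = y" by (rule cube_homotopyD(2)[OF F1])
    then show "cone_push (f1 (?c k x)) (s * bump n x) = y"
      using cone_push_0[OF y] \<open>x \<in> cube_boundary n\<close> by (simp add: bump_boundary)
  qed
  have H20: "(if k \<le> m then cone_push (f1 (?c k x)) (0 * bump n x) else f1 (?c k x)) = f1 (?c k x)"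
    if "k \<ge> 1" "x \<in> cube n" for k x
  proof -
    have "f1 (?c k x) \<in> topspace ?C"
      using funcset_mem[OF continuous_map_funspace[OF cube_homotopyD(1)[OF F1 \<open>1 \<le> k\<close>]], of "(0, x)"] that(2) by simp
    then show ?thesis by (simp add: cone_push_0)
  qed
  obtain f2 where f2: "he_based_map n ?C y f2" "he_class n ?C y f1 = he_class n ?C y f2"
    "\<And>k x. k \<ge> 1 \<Longrightarrow> x \<in> cube n \<Longrightarrow> f2 (?c k x)
       = (if k \<le> m then cone_push (f1 (?c k x)) (1 * bump n x) else f1 (?c k x))"
    by (rule deform_based_map[OF n f1(1) H2 H20]) (assumption | rule that)+
  \<comment> \<open>Here f drops out: a push by 1 ends at the vertex wherever it starts, and where
    the push is only partial the map already sits at y.\<close>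
  have f2': "f2 (?c k x) = cone_push y (bump n x)" if "k \<ge> 1" "k \<le> m" "x \<in> cube n" for k x
    using bump_or_clamp_boundary[OF that(3)]
  proof
    assume "bump n x = 1"
    then show ?thesis using that by (simp add: f2(3) cone_push_1)
  next
    assume "clamp_scale n 1 x \<in> cube_boundary n"
    then have "f (?c k (clamp_scale n 1 x)) = y"
      using cube_homotopyD(2)[OF F that(1), of 0] by simp
    then show ?thesis using that by (simp add: f2(3) f1(3))
  qed
  note F2 = he_based_map_cubes[OF n f2(1)]
  have H3: "cube_homotopy n ?C y (\<lambda>k s x. if k \<le> m then cone_push y ((1 - s) * bump n x) else f2 (?c k x))"
  proof (rule cube_homotopy_finite_modification[OF F2])
    have "continuous_map (top_of_set ({0..1} \<times> cube n)) ?C (\<lambda>z. cone_push y ((1 - fst z) * bump n (snd z)))"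
      by (rule continuous_map_cube_push)
         (auto intro!: continuous_on_mult continuous_on_diff continuous_on_const continuous_on_fst
           continuous_on_id continuous_on_bump sb y mult_le_one simp: bump_range[simplified])
    then show "continuous_map (top_of_set ({0..1} \<times> cube n)) ?C (\<lambda>(s, x). cone_push y ((1 - s) * bump n x))"
      by (simp add: case_prod_unfold)
  next
    fix k s x assume "x \<in> cube_boundary n"
    then show "cone_push y ((1 - s) * bump n x) = y" by (simp add: bump_boundary cone_push_0[OF y])
  qed
  obtain f3 where f3: "he_based_map n ?C y f3" "he_class n ?C y f2 = he_class n ?C y f3"
    "\<And>k x. k \<ge> 1 \<Longrightarrow> x \<in> cube n \<Longrightarrow> f3 (?c k x)
       = (if k \<le> m then cone_push y ((1 - 1) * bump n x) else f2 (?c k x))"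
    by (rule deform_based_map[OF n f2(1) H3]) (simp_all add: f2')
  show thesis
  proof (rule that[OF f3(1)])
    show "he_class n ?C y f = he_class n ?C y f3" using f1(2) f2(2) f3(2) by simp
  qed (simp_all add: f3(3) f2(3) f1(3) cone_push_0[OF y])
qed

section \<open>Projecting vertex-free families to X and correcting their height\<close>

text \<open>Since t < 1, the complement of the vertex is an open neighbourhood of the base point,
  and smallness applies to it.\<close>

lemma cube_homotopy_avoids_vertex:
  assumes H: "cube_homotopy n (cone_top X) (cone_proj (x0, t)) H" and "x0 \<in> topspace X" "0 \<le> t" "t < 1"
  obtains m where "\<And>k s x. k > m \<Longrightarrow> s \<in> {0..1} \<Longrightarrow> x \<in> cube n \<Longrightarrow> H k s x \<noteq> None"
proof -
  have "openin (cone_top X) (Some ` (topspace X \<times> (UNIV \<inter> {0..<1})))"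
    by (intro openin_cone_top_box openin_topspace open_UNIV)
  moreover have "cone_proj (x0, t) \<in> Some ` (topspace X \<times> (UNIV \<inter> {0..<1}))"
    using assms by (simp add: cone_proj_def)
  ultimately obtain m where "\<forall>k>m. \<forall>s\<in>{0..1}. \<forall>x\<in>cube n. H k s x \<in> Some ` (topspace X \<times> (UNIV \<inter> {0..<1}))"
    using cube_homotopyD(3)[OF H] by blast
  then show thesis by (intro that[of m]) fastforce
qed

text \<open>The X-coordinate of \<open>H\<close> is meaningful where \<open>H\<close> misses the
  vertex; on the first m spheres a family \<open>G\<close> in X stands in. Smallness in X follows
  from smallness in the cone, applied to the box over U of all heights below 1.\<close>

lemma cube_homotopy_project:
  assumes G: "cube_homotopy n X x0 G"
    and H: "cube_homotopy n (cone_top X) (cone_proj (x0, t)) H" and "x0 \<in> topspace X" "0 \<le> t" "t < 1"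
    and v: "\<And>k s x. k > m \<Longrightarrow> s \<in> {0..1} \<Longrightarrow> x \<in> cube n \<Longrightarrow> H k s x \<noteq> None"
  shows "cube_homotopy n X x0 (\<lambda>k s x. if k \<le> m then G k s x else fst (the (H k s x)))"
proof (rule cube_homotopyI)
  fix k :: nat assume "k \<ge> 1"
  show "continuous_map (top_of_set ({0..1} \<times> cube n)) X (\<lambda>(s, x). if k \<le> m then G k s x else fst (the (H k s x)))"
  proof (cases "k \<le> m")
    case True
    then show ?thesis using cube_homotopyD(1)[OF G \<open>k \<ge> 1\<close>] by simp
  next
    case False
    then have "continuous_map (top_of_set ({0..1} \<times> cube n)) X (\<lambda>z. fst (the ((\<lambda>(s, x). H k s x) z)))"
      by (intro cone_coordinates_continuous(1)[OF cube_homotopyD(1)[OF H \<open>k \<ge> 1\<close>]]) (use v in auto)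
    then show ?thesis using False by (simp add: case_prod_unfold)
  qed
next
  fix k s x assume "1 \<le> (k::nat)" "s \<in> {0..1::real}" "x \<in> cube_boundary n"
  then show "(if k \<le> m then G k s x else fst (the (H k s x))) = x0"
    using cube_homotopyD(2)[OF G] cube_homotopyD(2)[OF H] \<open>t < 1\<close> by (simp add: cone_proj_def)
next
  fix U assume U: "openin X U" "x0 \<in> U"
  have "openin (cone_top X) (Some ` (U \<times> (UNIV \<inter> {0..<1})))"
    by (intro openin_cone_top_box U(1) open_UNIV)
  moreover have "cone_proj (x0, t) \<in> Some ` (U \<times> (UNIV \<inter> {0..<1}))"
    using assms U by (simp add: cone_proj_def)
  ultimately obtain l where l: "\<forall>k>l. \<forall>s\<in>{0..1}. \<forall>x\<in>cube n. H k s x \<in> Some ` (U \<times> (UNIV \<inter> {0..<1}))"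
    using cube_homotopyD(3)[OF H] by blast
  have "fst (the (H k s x)) \<in> U" if "k > l" "s \<in> {0..1}" "x \<in> cube n" for k s x
  proof -
    have "H k s x \<in> Some ` (U \<times> (UNIV \<inter> {0..<1}))" using l that by blast
    then show ?thesis by auto
  qed
  then show "\<exists>m'. \<forall>k>m'. \<forall>s\<in>{0..1}. \<forall>x\<in>cube n. (if k \<le> m then G k s x else fst (the (H k s x))) \<in> U"
    by (intro exI[of _ "max l m"]) simp
qed

text \<open>Projection to X forgets the height. Moving the height linearly to t, with the
  X-coordinate fixed, joins a vertex-free map to its projection placed at level t.\<close>

lemma cube_homotopy_straight_line:
  assumes g: "cube_homotopy n (cone_top X) (cone_proj (x0, t)) (\<lambda>k s x. F k x)"
    and x0: "x0 \<in> topspace X" and t: "0 \<le> t" "t < 1"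
    and v: "\<And>k x. k \<ge> 1 \<Longrightarrow> x \<in> cube n \<Longrightarrow> F k x \<noteq> None"
  shows "cube_homotopy n (cone_top X) (cone_proj (x0, t))
     (\<lambda>k s x. cone_proj (fst (the (F k x)), (1 - s) * snd (the (F k x)) + s * t))"
proof (rule cube_homotopyI)
  have F: "fst (the (F k x)) \<in> topspace X" "0 \<le> snd (the (F k x))" "snd (the (F k x)) < 1"
    if k: "k \<ge> 1" and x: "x \<in> cube n" for k x
  proof -
    have "F k x \<in> topspace (cone_top X)"
      using funcset_mem[OF continuous_map_funspace[OF cube_homotopyD(1)[OF g k]], of "(0, x)"] x by simp
    then obtain a h where "F k x = Some (a, h)" "a \<in> topspace X" "0 \<le> h" "h < 1"
      using cone_top_cases[of "F k x" X] v[OF k x] by metis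
    then show "fst (the (F k x)) \<in> topspace X" "0 \<le> snd (the (F k x))" "snd (the (F k x)) < 1" by auto
  qed
  have conv: "(1 - s) * h + s * t \<in> {0..1}" if "s \<in> {0..1}" "0 \<le> h" "h < 1" for s h :: real
    using that t convex_bound_le[of h 1 t "1 - s" s] by simp
  fix k :: nat assume k: "k \<ge> 1"
  have ne: "(\<lambda>(s, x). F k x) z \<noteq> None" if "z \<in> topspace (top_of_set ({0..1::real} \<times> cube n))" for z
    using that v[OF k] by auto
  note C = cone_coordinates_continuous[OF cube_homotopyD(1)[OF g k] ne]
  have c1: "continuous_map (top_of_set ({0..1::real} \<times> cube n)) X (\<lambda>z. fst (the (F k (snd z))))"
    using C(1) by (simp add: case_prod_unfold)
  have c2: "continuous_map (top_of_set ({0..1::real} \<times> cube n)) euclideanreal (\<lambda>z. snd (the (F k (snd z))))"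
    using C(2) by (simp add: case_prod_unfold)
  have c3: "continuous_map (top_of_set ({0..1::real} \<times> cube n)) euclideanreal fst"
    by (simp add: continuous_on_fst continuous_on_id)
  have "continuous_map (top_of_set ({0..1::real} \<times> cube n)) (cone_top X)
      (\<lambda>z. cone_proj (fst (the (F k (snd z))), (1 - fst z) * snd (the (F k (snd z))) + fst z * t))"
  proof (rule continuous_map_cone_proj[OF c1])
    show "continuous_map (top_of_set ({0..1::real} \<times> cube n)) euclideanreal
        (\<lambda>z. (1 - fst z) * snd (the (F k (snd z))) + fst z * t)"
      by (intro continuous_map_add continuous_map_real_mult continuous_map_diff c2 c3
          continuous_map_const[THEN iffD2]) simp_all
  next
    fix z assume "z \<in> topspace (top_of_set ({0..1::real} \<times> cube n))"
    then show "(1 - fst z) * snd (the (F k (snd z))) + fst z * t \<in> {0..1}"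
      using F[OF k, of "snd z"] by (intro conv) auto
  qed
  then show "continuous_map (top_of_set ({0..1} \<times> cube n)) (cone_top X)
      (\<lambda>(s, x). cone_proj (fst (the (F k x)), (1 - s) * snd (the (F k x)) + s * t))"
    by (simp add: case_prod_unfold)
next
  fix k s x assume "1 \<le> (k::nat)" "s \<in> {0..1::real}" "x \<in> cube_boundary n"
  then have "F k x = cone_proj (x0, t)" by (rule cube_homotopyD(2)[OF g])
  then show "cone_proj (fst (the (F k x)), (1 - s) * snd (the (F k x)) + s * t) = cone_proj (x0, t)"
    using t by (simp add: cone_proj_def algebra_simps)
next
  fix U assume U: "openin (cone_top X) U" "cone_proj (x0, t) \<in> U"
  have op: "openin (prod_topology X unit_interval) {z \<in> topspace X \<times> {0..1}. cone_proj z \<in> U}"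
    using U(1) by (simp add: openin_cone_top cone_open_def)
  have mem: "(x0, t) \<in> {z \<in> topspace X \<times> {0..1}. cone_proj z \<in> U}" using U(2) x0 t by simp
  obtain V W where V: "openin X V" "x0 \<in> V" and W: "openin unit_interval W" "t \<in> W"
    and VW: "V \<times> W \<subseteq> {z \<in> topspace X \<times> {0..1}. cone_proj z \<in> U}"
    using op[unfolded openin_prod_topology_alt, THEN spec, THEN spec, THEN mp, OF mem] by (elim exE conjE)
  obtain W' where W': "open W'" "W = {0..1} \<inter> W'" using W(1) by (auto simp: openin_open)
  then obtain e where e: "e > 0" "ball t e \<subseteq> W'" using W(2) open_contains_ball by blast
  have "openin (cone_top X) (Some ` (V \<times> (ball t e \<inter> {0..<1})))"
    by (intro openin_cone_top_box V(1) open_ball)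
  moreover have "cone_proj (x0, t) \<in> Some ` (V \<times> (ball t e \<inter> {0..<1}))"
    using t V(2) e(1) by (simp add: cone_proj_def)
  ultimately obtain m where m: "\<forall>k>m. \<forall>s\<in>{0..1::real}. \<forall>x\<in>cube n. F k x \<in> Some ` (V \<times> (ball t e \<inter> {0..<1}))"
    using cube_homotopyD(3)[OF g] by blast
  have "cone_proj (fst (the (F k x)), (1 - s) * snd (the (F k x)) + s * t) \<in> U"
    if "k > m" "s \<in> {0..1}" "x \<in> cube n" for k s x
  proof -
    have "F k x \<in> Some ` (V \<times> (ball t e \<inter> {0..<1}))" using m that by blast
    then obtain a h where ah: "F k x = Some (a, h)" "a \<in> V" "h \<in> ball t e" "0 \<le> h" "h < 1" by auto
    \<comment> \<open>The heights are confined to a ball about t because balls are convex: the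
      straight line to t does not leave the neighbourhood.\<close>
    have "(1 - s) * h + s * t \<in> ball t e"
      using convexD[OF convex_ball, of h t e t "1 - s" s] ah(3) e(1) that(2) by simp
    moreover have "(1 - s) * h + s * t \<in> {0..1}"
      using that t ah convex_bound_le[of h 1 t "1 - s" s] by simp
    ultimately have "(a, (1 - s) * h + s * t) \<in> V \<times> W" using ah(2) e(2) W'(2) by blast
    then show ?thesis using VW ah(1) by auto
  qed
  then show "\<exists>m. \<forall>k>m. \<forall>s\<in>{0..1}. \<forall>x\<in>cube n.
      cone_proj (fst (the (F k x)), (1 - s) * snd (the (F k x)) + s * t) \<in> U" by blast
qed

section \<open>The homomorphism to the group of the cone\<close>

definition cone_level :: "nat \<Rightarrow> real \<Rightarrow> ((nat \<Rightarrow> real) \<Rightarrow> 'a) \<Rightarrow> (nat \<Rightarrow> real) \<Rightarrow> ('a \<times> real) option" where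
  "cone_level n t f = restrict (\<lambda>p. cone_proj (f p, t)) (hawaiian n)"

lemma cone_level_cube:
  "n \<ge> 1 \<Longrightarrow> k \<ge> 1 \<Longrightarrow> x \<in> cube n \<Longrightarrow> cone_level n t f (cube_to_sphere n k x) = cone_proj (f (cube_to_sphere n k x), t)"
  by (simp add: cone_level_def cube_to_sphere_in)

lemma continuous_map_cone_level:
  assumes "t \<in> {0..1}" shows "continuous_map X (cone_top X) (\<lambda>a. cone_proj (a, t))"
  using assms by (intro continuous_map_cone_proj) auto

lemma cone_level_based:
  assumes "t \<in> {0..1}" "he_based_map n X x0 f"
  shows "he_based_map n (cone_top X) (cone_proj (x0, t)) (cone_level n t f)"
proof -
  have "continuous_map (HE n) (cone_top X) ((\<lambda>a. cone_proj (a, t)) \<circ> f)"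
    using assms by (intro continuous_map_compose[OF _ continuous_map_cone_level]) (auto simp: he_based_map_def)
  then have "continuous_map (HE n) (cone_top X) (cone_level n t f)"
    by (rule continuous_map_eq) (simp add: cone_level_def)
  then show ?thesis
    using assms theta_in_hawaiian by (simp add: he_based_map_def cone_level_def)
qed

lemma cone_level_class:
  assumes n: "n \<ge> 1" and t: "t \<in> {0..1}"
    and f: "he_based_map n X x0 f" and g: "he_based_map n X x0 g"
    and fg: "he_class n X x0 f = he_class n X x0 g"
  shows "he_class n (cone_top X) (cone_proj (x0, t)) (cone_level n t f)
       = he_class n (cone_top X) (cone_proj (x0, t)) (cone_level n t g)"
proof -
  have "homotopic_with (\<lambda>h. h theta = x0) (HE n) X f g"
    using fg he_class_eq_iff[OF f g] by simp
  then have "homotopic_with (\<lambda>h. h theta = cone_proj (x0, t)) (HE n) (cone_top X)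
      ((\<lambda>a. cone_proj (a, t)) \<circ> f) ((\<lambda>a. cone_proj (a, t)) \<circ> g)"
    by (rule homotopic_with_compose_continuous_map_left[OF _ continuous_map_cone_level[OF t]]) simp
  then have "homotopic_with (\<lambda>h. h theta = cone_proj (x0, t)) (HE n) (cone_top X) (cone_level n t f) (cone_level n t g)"
    by (rule homotopic_with_eq) (auto simp: cone_level_def theta_in_hawaiian)
  then show ?thesis
    using he_class_eq_iff[OF cone_level_based[OF t f] cone_level_based[OF t g]] by simp
qed

text \<open>An equality of maps, not merely of classes: the level map acts on values and
  concatenation on arguments.\<close>

lemma cone_level_concat:
  assumes n: "n \<ge> 1" and t: "t \<in> {0..1}" and f: "he_based_map n X x0 f" and g: "he_based_map n X x0 g"
  shows "cone_level n t (he_concat n x0 f g)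
       = he_concat n (cone_proj (x0, t)) (cone_level n t f) (cone_level n t g)"
proof (rule extensional_eq_on_cubes[OF n])
  show "cone_level n t (he_concat n x0 f g) \<in> extensional (hawaiian n)"
    by (simp add: cone_level_def)
  show "he_concat n (cone_proj (x0, t)) (cone_level n t f) (cone_level n t g) \<in> extensional (hawaiian n)"
    unfolding he_concat_eq_descend by (rule descend_extensional)
  fix k x assume k: "1 \<le> (k::nat)" and x: "x \<in> cube n"
  have "he_concat n (cone_proj (x0, t)) (cone_level n t f) (cone_level n t g) (cube_to_sphere n k x)
      = cube_concat (\<lambda>x. cone_level n t f (cube_to_sphere n k x)) (\<lambda>x. cone_level n t g (cube_to_sphere n k x)) x"
    by (rule he_concat_based(2)[OF n cone_level_based[OF t f] cone_level_based[OF t g] k x])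
  also have "\<dots> = cube_concat (\<lambda>x. cone_proj (f (cube_to_sphere n k x), t)) (\<lambda>x. cone_proj (g (cube_to_sphere n k x), t)) x"
    by (rule cube_concat_cong[OF n x cone_level_cube[OF n k] cone_level_cube[OF n k]])
  also have "\<dots> = cone_proj (cube_concat (\<lambda>x. f (cube_to_sphere n k x)) (\<lambda>x. g (cube_to_sphere n k x)) x, t)"
    by (simp add: cube_concat_def)
  also have "\<dots> = cone_level n t (he_concat n x0 f g) (cube_to_sphere n k x)"
    unfolding cone_level_cube[OF n k x] he_concat_based(2)[OF n f g k x] by (rule refl)
  finally show "cone_level n t (he_concat n x0 f g) (cube_to_sphere n k x) =
      he_concat n (cone_proj (x0, t)) (cone_level n t f) (cone_level n t g) (cube_to_sphere n k x)" by simp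
qed

lemma cone_level_surj:
  assumes n: "n \<ge> 1" and x0: "x0 \<in> topspace X" and t: "0 \<le> t" "t < 1"
    and g: "he_based_map n (cone_top X) (cone_proj (x0, t)) g"
  obtains f where "he_based_map n X x0 f"
    "he_class n (cone_top X) (cone_proj (x0, t)) g
      = he_class n (cone_top X) (cone_proj (x0, t)) (cone_level n t f)"
proof -
  let ?C = "cone_top X" and ?y = "cone_proj (x0, t)" and ?c = "cube_to_sphere n"
  obtain m where m: "\<And>k s x. k > m \<Longrightarrow> s \<in> {0..1::real} \<Longrightarrow> x \<in> cube n \<Longrightarrow> g (?c k x) \<noteq> None"
    using cube_homotopy_avoids_vertex[OF he_based_map_cubes[OF n g] x0 t] by blast
  \<comment> \<open>The spheres that may meet the vertex are made constant at the base point, which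
    is not the vertex as t < 1; so g' misses the vertex everywhere.\<close>
  obtain g' where g': "he_based_map n ?C ?y g'" "he_class n ?C ?y g = he_class n ?C ?y g'"
    "\<And>k x. k \<ge> 1 \<Longrightarrow> k \<le> m \<Longrightarrow> x \<in> cube n \<Longrightarrow> g' (?c k x) = ?y"
    "\<And>k x. k > m \<Longrightarrow> x \<in> cube n \<Longrightarrow> g' (?c k x) = g (?c k x)"
    using cone_contract_finitely_many_spheres[OF n g, of m] by metis
  have v: "g' (?c k x) \<noteq> None" if "k \<ge> 1" "x \<in> cube n" for k x
    using that g'(3)[of k x] g'(4)[of k x] m[of k 0 x] t(2) by (cases "k \<le> m") (auto simp: cone_proj_def)
  note G = he_based_map_cubes[OF n g'(1)]
  \<comment> \<open>With bound 0 the projection applies to every sphere, since spheres are numbered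
    from 1.\<close>
  have "cube_homotopy n X x0 (\<lambda>k s x. if k \<le> 0 then x0 else fst (the (g' (?c k x))))"
    by (rule cube_homotopy_project[OF cube_homotopy_const[OF x0] G x0 t v]) auto
  then have "cube_homotopy n X x0 (\<lambda>k s x. fst (the (g' (?c k x))))"
    by (rule cube_homotopy_cong) simp
  note f = he_based_map_descend[OF n this]
  have t': "t \<in> {0..1}" using t by simp
  have "he_class n ?C ?y g' = he_class n ?C ?y (cone_level n t (descend n x0 (\<lambda>k x. fst (the (g' (?c k x))))))"
  proof (rule he_class_eqI[OF n g'(1) cone_level_based[OF t' f(1)] cube_homotopy_straight_line[OF G x0 t v]])
    fix k x assume k: "1 \<le> (k::nat)" and x: "x \<in> cube n"
    have "g' (?c k x) \<in> topspace ?C"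
      using funcset_mem[OF continuous_map_funspace[OF cube_homotopyD(1)[OF G k]], of "(0, x)"] x by simp
    then obtain a h where "g' (?c k x) = Some (a, h)" "h < 1"
      using cone_top_cases[of "g' (?c k x)" X] v[OF k x] by metis
    then show "cone_proj (fst (the (g' (?c k x))), (1 - 0) * snd (the (g' (?c k x))) + 0 * t) = g' (?c k x)"
      by (simp add: cone_proj_def)
    show "cone_proj (fst (the (g' (?c k x))), (1 - 1) * snd (the (g' (?c k x))) + 1 * t)
        = cone_level n t (descend n x0 (\<lambda>k x. fst (the (g' (?c k x))))) (?c k x)"
      unfolding cone_level_cube[OF n k x] f(2)[OF k x] by simp
  qed
  then show thesis using that[OF f(1)] g'(2) by simp
qed

lemma cone_level_kernel:
  assumes n: "n \<ge> 1" and x0: "x0 \<in> topspace X" and t: "0 \<le> t" "t < 1"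
    and f: "he_based_map n X x0 f"
  shows "he_class n (cone_top X) (cone_proj (x0, t)) (cone_level n t f)
      = he_class n (cone_top X) (cone_proj (x0, t)) (const_map n (cone_proj (x0, t)))
    \<longleftrightarrow> he_class n X x0 f \<in> weak_product_sub n X x0"
proof -
  let ?C = "cone_top X" and ?y = "cone_proj (x0, t)" and ?c = "cube_to_sphere n"
  have t': "t \<in> {0..1}" using t by simp
  have y: "?y \<in> topspace ?C" using x0 t by (auto simp: topspace_cone_top)
  note cb = const_map_based[OF y, of n]
  show ?thesis
  proof
    assume "he_class n ?C ?y (cone_level n t f) = he_class n ?C ?y (const_map n ?y)"
    then have "homotopic_with (\<lambda>h. h theta = ?y) (HE n) ?C (cone_level n t f) (const_map n ?y)"
      using he_class_eq_iff[OF cone_level_based[OF t' f] cb] by simp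
    then obtain H where H: "cube_homotopy n ?C ?y H" "\<And>k x. H k 0 x = cone_level n t f (?c k x)"
      "\<And>k x. H k 1 x = const_map n ?y (?c k x)"
      using cube_homotopy_of_homotopic[OF n] by metis
    obtain m where m: "\<And>k s x. k > m \<Longrightarrow> s \<in> {0..1} \<Longrightarrow> x \<in> cube n \<Longrightarrow> H k s x \<noteq> None"
      using cube_homotopy_avoids_vertex[OF H(1) x0 t] by metis
    \<comment> \<open>The first m spheres keep f throughout, and on the others the projected
      null-homotopy ends at \<open>x0\<close>. Thus f is deformed inside X to a map trivial beyond
      m.\<close>
    note K = cube_homotopy_project[OF he_based_map_cubes[OF n f] H(1) x0 t m]
    have K0: "(if k \<le> m then f (?c k x) else fst (the (H k 0 x))) = f (?c k x)" if "k \<ge> 1" "x \<in> cube n" for k x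
      unfolding H(2) cone_level_cube[OF n that] using t by (simp add: cone_proj_def)
    obtain f' where f': "he_based_map n X x0 f'" "he_class n X x0 f = he_class n X x0 f'"
      "\<And>k x. k \<ge> 1 \<Longrightarrow> x \<in> cube n \<Longrightarrow> f' (?c k x) = (if k \<le> m then f (?c k x) else fst (the (H k 1 x)))"
      by (rule deform_based_map[OF n f K K0]) (assumption | rule that)+
    have "f' p = x0" if "k > m" "p \<in> HE_sphere n k" for k p
    proof -
      have k: "k \<ge> 1" using that by simp
      have "p \<in> ?c k ` cube n" unfolding cube_to_sphere_image[OF n k] by (rule that(2))
      then obtain x where x: "x \<in> cube n" "p = ?c k x" by (elim imageE)
      show ?thesis
        unfolding x(2) f'(3)[OF k x(1)] H(3) const_map_cube[OF n k x(1)]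
        using t that by (simp add: cone_proj_def)
    qed
    then show "he_class n X x0 f \<in> weak_product_sub n X x0"
      unfolding weak_product_sub_def using f'(1,2) by blast
  next
    assume "he_class n X x0 f \<in> weak_product_sub n X x0"
    then obtain f' m where f': "he_based_map n X x0 f'" "he_class n X x0 f = he_class n X x0 f'"
      "\<forall>k>m. \<forall>p\<in>HE_sphere n k. f' p = x0"
      unfolding weak_product_sub_def by blast
    obtain g where g: "he_based_map n ?C ?y g" "he_class n ?C ?y (cone_level n t f') = he_class n ?C ?y g"
      "\<And>k x. k \<ge> 1 \<Longrightarrow> k \<le> m \<Longrightarrow> x \<in> cube n \<Longrightarrow> g (?c k x) = ?y"
      "\<And>k x. k > m \<Longrightarrow> x \<in> cube n \<Longrightarrow> g (?c k x) = cone_level n t f' (?c k x)"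
      using cone_contract_finitely_many_spheres[OF n cone_level_based[OF t' f'(1)], of m] by metis
    \<comment> \<open>The first m spheres were made constant by the contraction, and the others were
      constant already and have been left alone; so g is the constant map itself.\<close>
    have "g = const_map n ?y"
    proof (rule extensional_eq_on_cubes[OF n])
      show "g \<in> extensional (hawaiian n)" "const_map n ?y \<in> extensional (hawaiian n)"
        using g(1) cb by (simp_all add: he_based_map_def)
      fix k x assume k: "1 \<le> (k::nat)" and x: "x \<in> cube n"
      show "g (?c k x) = const_map n ?y (?c k x)"
        unfolding const_map_cube[OF n k x]
      proof (cases "k \<le> m")
        case True then show "g (?c k x) = ?y" using g(3) k x by simp
      next
        case False
        then have "f' (?c k x) = x0" using f'(3)[THEN spec[of _ k]] cube_to_sphere_in(1)[OF n k x] by simp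
        then show "g (?c k x) = ?y"
          using g(4)[of k x] False x cone_level_cube[OF n k x, of t f'] by simp
      qed
    qed
    then show "he_class n ?C ?y (cone_level n t f) = he_class n ?C ?y (const_map n ?y)"
      using cone_level_class[OF n t' f f'(1,2)] g(2) by simp
  qed
qed

theorem theorem2p13:
  fixes X :: "'a topology" and x0 :: 'a and n :: nat and t :: real
  assumes "n \<ge> 1" and "x0 \<in> topspace X" and "0 \<le> t" and "t < 1"
  shows "hawaiian_group n (cone_top X) (cone_proj (x0, t))
           \<cong> (hawaiian_group n X x0 Mod weak_product_sub n X x0)"
proof -
  note n = assms(1) and x0 = assms(2)
  let ?y = "cone_proj (x0, t)"
  let ?G = "hawaiian_group n X x0" and ?H = "hawaiian_group n (cone_top X) ?y"
  have t: "t \<in> {0..1}" using assms by simp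
  have y: "?y \<in> topspace (cone_top X)" using x0 t by (auto simp: topspace_cone_top)
  \<comment> \<open>Defined through a chosen representative; homotopy invariance of
    \<open>cone_level\<close> then permits any other.\<close>
  define \<Psi> where "\<Psi> = (\<lambda>A. he_class n (cone_top X) ?y (cone_level n t (SOME f. f \<in> A)))"
  have \<Psi>: "\<Psi> (he_class n X x0 f) = he_class n (cone_top X) ?y (cone_level n t f)" if f: "he_based_map n X x0 f" for f
  proof -
    note s = he_class_some[OF f]
    have "he_class n X x0 f = he_class n X x0 (SOME g. g \<in> he_class n X x0 f)"
      using he_class_eq_iff[OF f s(1)] s(2) by simp
    then show ?thesis
      unfolding \<Psi>_def by (rule cone_level_class[OF n t f s(1), symmetric])
  qed
  have "\<Psi> \<in> hom ?G ?H"
  proof (rule homI)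
    fix A assume "A \<in> carrier ?G"
    then obtain f where f: "A = he_class n X x0 f" "he_based_map n X x0 f" by (elim carrier_hawaiian_groupE)
    show "\<Psi> A \<in> carrier ?H"
      unfolding f(1) \<Psi>[OF f(2)] by (rule he_class_in_carrier[OF cone_level_based[OF t f(2)]])
  next
    fix A B assume "A \<in> carrier ?G" "B \<in> carrier ?G"
    then obtain f g where f: "A = he_class n X x0 f" "he_based_map n X x0 f"
      and g: "B = he_class n X x0 g" "he_based_map n X x0 g" by (elim carrier_hawaiian_groupE)
    show "\<Psi> (A \<otimes>\<^bsub>?G\<^esub> B) = \<Psi> A \<otimes>\<^bsub>?H\<^esub> \<Psi> B"
      unfolding f(1) g(1) \<Psi>[OF f(2)] \<Psi>[OF g(2)] hawaiian_mult[OF n f(2) g(2)]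
        \<Psi>[OF he_concat_based(1)[OF n f(2) g(2)]]
        hawaiian_mult[OF n cone_level_based[OF t f(2)] cone_level_based[OF t g(2)]]
        cone_level_concat[OF n t f(2) g(2)]
      by (rule refl)
  qed
  then interpret \<Psi>: group_hom ?G ?H \<Psi>
    using group_hawaiian_group[OF n x0] group_hawaiian_group[OF n y]
    by (simp add: group_hom_def group_hom_axioms_def)
  have "carrier ?H \<subseteq> \<Psi> ` carrier ?G"
  proof
    fix B assume "B \<in> carrier ?H"
    then obtain g where g: "B = he_class n (cone_top X) ?y g" "he_based_map n (cone_top X) ?y g"
      by (elim carrier_hawaiian_groupE)
    obtain f where f: "he_based_map n X x0 f" "B = he_class n (cone_top X) ?y (cone_level n t f)"
      using cone_level_surj[OF n x0 assms(3,4) g(2)] g(1) by metis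
    then show "B \<in> \<Psi> ` carrier ?G"
      using \<Psi>[OF f(1)] he_class_in_carrier[OF f(1)] by (metis image_eqI)
  qed
  then have "\<Psi> ` carrier ?G = carrier ?H" using \<Psi>.hom_closed by blast
  \<comment> \<open>The first isomorphism theorem; the identification of the kernel below makes the
    weak product a normal subgroup.\<close>
  then have "?G Mod kernel ?G ?H \<Psi> \<cong> ?H" by (rule \<Psi>.FactGroup_iso)
  moreover have "kernel ?G ?H \<Psi> = weak_product_sub n X x0"
  proof (rule Set.set_eqI)
    fix A
    show "A \<in> kernel ?G ?H \<Psi> \<longleftrightarrow> A \<in> weak_product_sub n X x0"
    proof (cases "A \<in> carrier ?G")
      case True
      then obtain f where f: "A = he_class n X x0 f" "he_based_map n X x0 f" by (elim carrier_hawaiian_groupE)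
      have "A \<in> kernel ?G ?H \<Psi> \<longleftrightarrow> \<Psi> A = \<one>\<^bsub>?H\<^esub>" using True by (simp add: kernel_def)
      then show ?thesis
        unfolding f(1) \<Psi>[OF f(2)] hawaiian_group_simps(2)
        using cone_level_kernel[OF n x0 assms(3,4) f(2)] by simp
    next
      case False
      moreover have "weak_product_sub n X x0 \<subseteq> carrier ?G"
        unfolding weak_product_sub_def hawaiian_group_simps by blast
      ultimately show ?thesis by (auto simp: kernel_def)
    qed
  qed
  \<comment> \<open>Reversing the isomorphism with \<open>group.iso_sym\<close> requires its source,
    the quotient, to be a group.\<close>
  moreover have "group (?G Mod kernel ?G ?H \<Psi>)"
    by (rule normal.factorgroup_is_group[OF \<Psi>.normal_kernel])
  ultimately show ?thesis using group.iso_sym by metis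
qed

end
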